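(* Let $d\ge1$ and $t\in(0,\frac d2)$ be fixed, and let $$p_{\log}(t,x,y)=\frac1{(2\pi)^d}\int_{[-\pi,\pi]^d}\Phi(\xi)^{-t}\,e^{i(x-y)\cdot\xi}\,d\xi,\qquad \Phi(\xi)=\sum_{j=1}^d(2-2\cos\xi_j),$$ be the log-diffusion kernel on the standard lattice $\mathbb Z^d$. Then, for $x,y\in\mathbb Z^d$, $$\lim_{|x-y|\to\infty}|x-y|^{\,d-2t}\,p_{\log}(t,x,y)=\frac{A_{-t,d}}{(2\pi)^d},\qquad A_{-t,d}=\lim_{N\to\infty}\int_{\mathbb R^d}|\eta|^{-2t}\,\chi\Bigl(\frac\eta N\Bigr)e^{i\omega\cdot\eta}\,d\eta .$$
   Context: The standard lattice $\mathbb Z^d$ carries unit vertex measure and unit edge weights between nearest neighbours; $p_{\log}(t,x,y)=(e^{-t\log(-\Delta)}\delta_y)(x)$ is the kernel of the semigroup with Fourier multiplier $\Phi(\xi)^{-t}$. $|\cdot|$ is the Euclidean norm. In the definition of $A_{-t,d}$, $\omega\in\mathbb S^{d-1}$ is any unit vector and $\chi\in C_c^\infty(\mathbb R^d)$ is any radial function with $\chi(\eta)=1$ for $|\eta|\le\frac12$ and $\chi(\eta)=0$ for $|\eta|\ge1$; the limit exists, is finite, and depends only on $d$ and $t$ (not on $\chi$ or $\omega$). *)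

theory Defs
  imports "HOL-Analysis.Analysis"
begin

definition lattice_vec :: "int ^ 'd \<Rightarrow> real ^ 'd" where
  "lattice_vec x = (\<chi> j. real_of_int (x $ j))"

definition Phi :: "real ^ 'd \<Rightarrow> real" where
  "Phi \<xi> = (\<Sum>j\<in>UNIV. 2 - 2 * cos (\<xi> $ j))"

text \<open>Since \<open>0 powr a = 0\<close>, the integrand below vanishes at the zero \<open>\<xi> = 0\<close> of the symbol; this
  affects only a null set, and likewise in \<open>A_trunc\<close> at \<open>\<eta> = 0\<close>.\<close>

definition p_log :: "real \<Rightarrow> int ^ 'd \<Rightarrow> int ^ 'd \<Rightarrow> complex" where
  "p_log t x y = complex_of_real (1 / (2 * pi) ^ CARD('d)) *
     (LINT \<xi> : cbox (\<chi> j. - pi) (\<chi> j. pi) | lborel.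
        complex_of_real (Phi \<xi> powr (- t)) *
        exp (\<i> * complex_of_real ((lattice_vec x - lattice_vec y) \<bullet> \<xi>)))"

text \<open>\<open>Ck k f\<close>: all iterated directional derivatives of \<open>f\<close> of order at most \<open>k\<close> exist, those of
  order less than \<open>k\<close> are Frechet differentiable, and those of order \<open>k\<close> are continuous.\<close>

primrec Ck :: "nat \<Rightarrow> ('a::real_normed_vector \<Rightarrow> 'b::real_normed_vector) \<Rightarrow> bool" where
  "Ck 0 f \<longleftrightarrow> continuous_on UNIV f"
| "Ck (Suc k) f \<longleftrightarrow> (\<forall>x. f differentiable (at x)) \<and>
     (\<forall>v. Ck k (\<lambda>x. frechet_derivative f (at x) v))"

definition smooth :: "('a::real_normed_vector \<Rightarrow> 'b::real_normed_vector) \<Rightarrow> bool" where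
  "smooth f \<longleftrightarrow> (\<forall>k. Ck k f)"

text \<open>Compactness of the support is implied by the last condition.\<close>

definition radial_cutoff :: "(real ^ 'd \<Rightarrow> complex) \<Rightarrow> bool" where
  "radial_cutoff \<kappa> \<longleftrightarrow> smooth \<kappa> \<and>
     (\<forall>\<eta> \<eta>'. norm \<eta> = norm \<eta>' \<longrightarrow> \<kappa> \<eta> = \<kappa> \<eta>') \<and>
     (\<forall>\<eta>. norm \<eta> \<le> 1 / 2 \<longrightarrow> \<kappa> \<eta> = 1) \<and>
     (\<forall>\<eta>. norm \<eta> \<ge> 1 \<longrightarrow> \<kappa> \<eta> = 0)"

definition A_trunc :: "real \<Rightarrow> (real ^ 'd \<Rightarrow> complex) \<Rightarrow> real ^ 'd \<Rightarrow> real \<Rightarrow> complex" where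
  "A_trunc t \<kappa> \<omega> N =
     (LINT \<eta> | lborel. complex_of_real (norm \<eta> powr (- 2 * t)) * \<kappa> (\<eta> /\<^sub>R N) *
        exp (\<i> * complex_of_real (\<omega> \<bullet> \<eta>)))"

text \<open>The constant \<open>A\<^bsub>-t,d\<^esub>\<close>, with \<open>d = CARD('d)\<close>. The cutoff \<open>\<kappa>\<close> and the unit vector \<open>\<omega>\<close> are
  parameters of the defining limit although its value does not depend on them.\<close>

definition A_const :: "real \<Rightarrow> (real ^ 'd \<Rightarrow> complex) \<Rightarrow> real ^ 'd \<Rightarrow> complex" where
  "A_const t \<kappa> \<omega> = Lim at_top (A_trunc t \<kappa> \<omega>)"

end

theory Submission
  imports Defs "HOL-Probability.Characteristic_Functions" "HOL-Real_Asymp.Real_Asymp"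
begin

text \<open>Both sides of the asymptotics are negative powers of a nonnegative function, \<open>\<Phi>(\<xi>)\<close> on the torus
and \<open>\<bar>\<eta>\<bar>\<^sup>2\<close> on space, and the Gamma integral
\<open>\<psi> powr - t = 1 / Gamma t * (\<integral> s powr (t - 1) * exp (- s * \<psi>) ds)\<close> (lemma \<open>subordination\<close>) writes both as
superpositions of heat kernels. The kernel \<open>p_log\<close> at distance \<open>r\<close> becomes, after \<open>s = r\<^sup>2 u\<close>, the
integral against \<open>u powr (t - 1)\<close> of the rescaled lattice heat kernel, which converges to the Gaussian
\<open>(pi / u) powr (d / 2) * exp (- 1 / (4 * u))\<close> with no dependence on the direction, because the Fourier
transform of a Gaussian is radial (\<open>lattice_heat_limit\<close>). The truncated integral \<open>A_trunc\<close> becomes the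
same integral of Fourier transforms of truncated Gaussians, which converge to the same function as the
cutoff is removed (\<open>A_trunc_tendsto\<close>). The common limit is \<open>riesz_constant\<close>; this shows at once that
\<open>A_const\<close> exists and that it depends neither on the cutoff nor on the direction.

Exchanging the limits with the \<open>u\<close>-integral takes a dominating function, and both times it is a
multiple of \<open>u powr (t - 1) * min 1 (u powr - (d / 2))\<close>, integrable exactly because \<open>0 < t < d / 2\<close>.
The factor \<open>u powr - (d / 2)\<close> is the trivial on-diagonal bound. The bound by \<open>1\<close> for small \<open>u\<close> is
where oscillation enters: \<open>d\<close> integrations by parts in a direction in which the phase has
frequency comparable to \<open>1\<close> gain exactly the lost power of the length scale.
The scale is \<open>R = min L (1 / sqrt s)\<close>, with \<open>L\<close> the cutoff radius or \<open>pi\<close>, and every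
integration by parts gains a factor \<open>1 / R\<close>
(\<open>cutoff_gaussian_fourier_decay\<close> and \<open>torus_heat_fourier_decay\<close>). On the lattice the integrations by
parts are needed in one variable only, since the heat kernel is a product over the coordinates.\<close>

section \<open>Gaussian integrals\<close>

text \<open>Lebesgue measure on a Euclidean space is the image of the product measure over the basis.\<close>

lemma integral_prod_Basis:
  fixes f :: "'a::euclidean_space \<Rightarrow> real \<Rightarrow> complex"
  assumes "\<And>b. b \<in> Basis \<Longrightarrow> integrable lborel (f b)"
  shows "(LINT x|lborel. (\<Prod>b\<in>Basis. f b (x \<bullet> b))) = (\<Prod>b\<in>Basis. LINT y|lborel. f b y)"
    and "integrable lborel (\<lambda>x::'a. \<Prod>b\<in>Basis. f b (x \<bullet> b))"
proof -
  interpret product_sigma_finite "\<lambda>_::'a. lborel :: real measure"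
    by standard
  define T :: "('a \<Rightarrow> real) \<Rightarrow> 'a" where "T y = (\<Sum>b\<in>Basis. y b *\<^sub>R b)" for y
  have T: "T \<in> measurable (\<Pi>\<^sub>M b\<in>Basis. lborel) borel"
    unfolding T_def by measurable
  have lb: "(lborel :: 'a measure) = distr (\<Pi>\<^sub>M b\<in>Basis. lborel) borel T"
    unfolding T_def[abs_def] lborel_def[where 'a='a] lborel_eq_real ..
  have [measurable]: "f b \<in> borel_measurable borel" if "b \<in> Basis" for b
    using borel_measurable_integrable[OF assms[OF that]] by simp
  have m: "(\<lambda>x::'a. \<Prod>b\<in>Basis. f b (x \<bullet> b)) \<in> borel_measurable borel"
    by measurable
  have Tb: "T y \<bullet> b = y b" if "b \<in> Basis" for y b
    using that by (simp add: T_def inner_sum_left inner_Basis if_distrib sum.delta cong: if_cong)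
  have eq: "(\<Prod>b\<in>Basis. f b (T y \<bullet> b)) = (\<Prod>b\<in>Basis. f b (y b))" for y
    by (intro prod.cong) (auto simp: Tb)
  show "(LINT x|lborel. (\<Prod>b\<in>Basis. f b (x \<bullet> b))) = (\<Prod>b\<in>Basis. LINT y|lborel. f b y)"
    unfolding lb integral_distr[OF T m] eq by (rule product_integral_prod) (auto intro: assms)
  show "integrable lborel (\<lambda>x::'a. \<Prod>b\<in>Basis. f b (x \<bullet> b))"
    unfolding lb integrable_distr_eq[OF T m] eq by (rule product_integrable_prod) (auto intro: assms)
qed

text \<open>The characteristic function of the standard normal distribution after the substitution
\<open>x \<mapsto> sqrt (2 * u) * x\<close>.\<close>

lemma gaussian_fourier_real:
  fixes u k :: real
  assumes "u > 0"
  shows "integrable lborel (\<lambda>x. complex_of_real (exp (- u * x\<^sup>2)) * exp (\<i> * complex_of_real (k * x)))"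
    and "(LINT x|lborel. complex_of_real (exp (- u * x\<^sup>2)) * exp (\<i> * complex_of_real (k * x)))
      = complex_of_real (sqrt (pi / u) * exp (- k\<^sup>2 / (4 * u)))"
proof -
  define t where "t = k / sqrt (2 * u)"
  define g where "g x = std_normal_density x *\<^sub>R exp (\<i> * complex_of_real (t * x))" for x
  have su: "sqrt (2 * u) > 0" using assms by simp
  have "integrable lborel g"
  proof (rule Bochner_Integration.integrable_bound)
    show "integrable lborel (std_normal_density)" by simp
    show "g \<in> borel_measurable lborel"
      unfolding g_def by measurable
  qed (auto simp: g_def)
  then have i: "integrable lborel (\<lambda>x. g (0 + sqrt (2 * u) * x))"
    using su by (intro lborel_integrable_real_affine) auto
  have geq: "complex_of_real (sqrt (2*pi)) * g (0 + sqrt (2 * u) * x) =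
     complex_of_real (exp (- u * x\<^sup>2)) * exp (\<i> * complex_of_real (k * x))" for x
  proof -
    have 1: "t * (0 + sqrt (2 * u) * x) = k * x" using su by (simp add: t_def)
    have 2: "sqrt (2 * pi) * std_normal_density (0 + sqrt (2 * u) * x) = exp (- u * x\<^sup>2)"
      using assms by (simp add: std_normal_density_def power_mult_distrib)
    show ?thesis
      unfolding g_def 1 2[symmetric] by (simp only: scaleR_conv_of_real of_real_mult mult.assoc)
  qed
  show "integrable lborel (\<lambda>x. complex_of_real (exp (- u * x\<^sup>2)) * exp (\<i> * complex_of_real (k * x)))"
    using integrable_mult_right[OF i, of "complex_of_real (sqrt (2*pi))"] unfolding geq .
  have "char std_normal_distribution t = integral\<^sup>L lborel g"
    unfolding char_def g_def by (subst integral_density) auto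
  then have "integral\<^sup>L lborel g = complex_of_real (exp (- (t^2) / 2))"
    by (simp add: char_std_normal_distribution)
  moreover have "integral\<^sup>L lborel g = \<bar>sqrt (2*u)\<bar> *\<^sub>R (LINT x|lborel. g (0 + sqrt (2 * u) * x))"
    using su by (intro lborel_integral_real_affine) auto
  ultimately have "(LINT x|lborel. g (0 + sqrt (2 * u) * x)) = complex_of_real (exp (- (t^2) / 2) / sqrt (2*u))"
    using su by (simp add: scaleR_conv_of_real field_simps)
  then have "(LINT x|lborel. complex_of_real (sqrt (2*pi)) * g (0 + sqrt (2 * u) * x))
     = complex_of_real (sqrt (2*pi)) * complex_of_real (exp (- (t^2) / 2) / sqrt (2*u))"
    by simp
  also have "\<dots> = complex_of_real (sqrt (2 * pi) / sqrt (2 * u) * exp (- (t^2) / 2))"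
    by simp
  also have "sqrt (2 * pi) / sqrt (2 * u) = sqrt (pi / u)"
    by (simp add: real_sqrt_divide[symmetric])
  also have "- (t^2) / 2 = - k\<^sup>2 / (4 * u)"
    using assms by (simp add: t_def power_divide)
  finally show "(LINT x|lborel. complex_of_real (exp (- u * x\<^sup>2)) * exp (\<i> * complex_of_real (k * x)))
      = complex_of_real (sqrt (pi / u) * exp (- k\<^sup>2 / (4 * u)))"
    unfolding geq .
qed

lemma gaussian_fourier:
  fixes w :: "'a::euclidean_space"
  assumes "u > 0"
  shows "integrable lborel (\<lambda>x::'a. complex_of_real (exp (- u * (norm x)\<^sup>2)) * exp (\<i> * complex_of_real (w \<bullet> x)))"
    and "(LINT x|lborel. complex_of_real (exp (- u * (norm x)\<^sup>2)) * exp (\<i> * complex_of_real (w \<bullet> x)))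
      = complex_of_real (sqrt (pi / u) ^ DIM('a) * exp (- (norm w)\<^sup>2 / (4 * u)))"
proof -
  define f where "f b y = complex_of_real (exp (- u * y\<^sup>2)) * exp (\<i> * complex_of_real ((w \<bullet> b) * y))" for b :: 'a and y
  have n2: "(norm x)\<^sup>2 = (\<Sum>b\<in>Basis. (x \<bullet> b)\<^sup>2)" for x :: 'a
    unfolding power2_norm_eq_inner by (subst euclidean_inner) (simp add: power2_eq_square)
  have fi: "integrable lborel (f b)" and fv: "(LINT y|lborel. f b y) = complex_of_real (sqrt (pi / u) * exp (- (w \<bullet> b)\<^sup>2 / (4 * u)))" for b
    unfolding f_def by (rule gaussian_fourier_real[OF assms])+
  have eq: "complex_of_real (exp (- u * (norm x)\<^sup>2)) * exp (\<i> * complex_of_real (w \<bullet> x)) = (\<Prod>b\<in>Basis. f b (x \<bullet> b))" for x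
    unfolding f_def prod.distrib exp_sum[OF finite_Basis, symmetric] of_real_prod[symmetric]
    by (simp add: n2 sum_distrib_left sum_negf[symmetric] euclidean_inner[of w x])
  show "integrable lborel (\<lambda>x::'a. complex_of_real (exp (- u * (norm x)\<^sup>2)) * exp (\<i> * complex_of_real (w \<bullet> x)))"
    unfolding eq by (rule integral_prod_Basis) (rule fi)
  have "(LINT x|lborel. (\<Prod>b\<in>Basis. f b (x \<bullet> b))) = (\<Prod>b\<in>Basis. complex_of_real (sqrt (pi / u) * exp (- (w \<bullet> b)\<^sup>2 / (4 * u))))"
    using fi by (subst integral_prod_Basis) (auto simp: fv)
  also have "\<dots> = complex_of_real (sqrt (pi / u) ^ DIM('a) * exp (- (norm w)\<^sup>2 / (4 * u)))"
    unfolding of_real_prod[symmetric] prod.distrib exp_sum[OF finite_Basis, symmetric]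
    by (simp add: n2[of w] sum_divide_distrib sum_negf[symmetric])
  finally show "(LINT x|lborel. complex_of_real (exp (- u * (norm x)\<^sup>2)) * exp (\<i> * complex_of_real (w \<bullet> x)))
      = complex_of_real (sqrt (pi / u) ^ DIM('a) * exp (- (norm w)\<^sup>2 / (4 * u)))"
    unfolding eq .
qed

lemma gaussian_integral:
  assumes "u > 0"
  shows "integrable lborel (\<lambda>x::'a::euclidean_space. exp (- u * (norm x)\<^sup>2))"
    and "(LINT x::'a|lborel. exp (- u * (norm x)\<^sup>2)) = sqrt (pi / u) ^ DIM('a)"
proof -
  have i: "integrable lborel (\<lambda>x::'a. complex_of_real (exp (- u * (norm x)\<^sup>2)))"
    using gaussian_fourier(1)[OF assms, of "0::'a"] by simp
  show "integrable lborel (\<lambda>x::'a::euclidean_space. exp (- u * (norm x)\<^sup>2))"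
    using i by (simp only: complex_of_real_integrable_eq)
  have "complex_of_real (LINT x::'a|lborel. exp (- u * (norm x)\<^sup>2)) = complex_of_real (sqrt (pi / u) ^ DIM('a))"
    unfolding integral_complex_of_real[symmetric]
    using gaussian_fourier(2)[OF assms, of "0::'a"] by simp
  then show "(LINT x::'a|lborel. exp (- u * (norm x)\<^sup>2)) = sqrt (pi / u) ^ DIM('a)"
    unfolding of_real_eq_iff .
qed

text \<open>Half of a Gaussian absorbs any polynomial factor. The constant comes from
\<open>(1 + x / b) ^ b \<le> exp x\<close> at \<open>x = c * y\<^sup>2\<close>.\<close>

lemma power_le_exp_square:
  fixes c :: real
  assumes "c > 0"
  obtains D where "D \<ge> 0" "\<And>y. y \<ge> 0 \<Longrightarrow> y ^ b \<le> D * exp (c * y\<^sup>2)"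
proof
  show "1 + (real b / c) ^ b \<ge> 0" using assms by simp
  fix y :: real assume y: "y \<ge> 0"
  have e: "exp (c * y\<^sup>2) \<ge> 1" using assms by simp
  have P: "(real b / c) ^ b \<ge> 0" using assms by simp
  show "y ^ b \<le> (1 + (real b / c) ^ b) * exp (c * y\<^sup>2)"
  proof (cases "b = 0 \<or> y \<le> 1")
    case True
    then have "y ^ b \<le> 1" using y by (auto intro: power_le_one)
    also have "1 \<le> (1 + (real b / c) ^ b) * exp (c * y\<^sup>2)"
      using mult_mono[of 1 "1 + (real b / c) ^ b" 1 "exp (c * y\<^sup>2)"] e P by simp
    finally show ?thesis .
  next
    case False
    then have b: "b > 0" and y1: "y \<ge> 1" by auto
    have "y ^ b \<le> (y\<^sup>2) ^ b"
      using y1 by (intro power_mono) (auto simp: power2_eq_square)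
    also have "\<dots> = (real b / c) ^ b * (c * y\<^sup>2 / real b) ^ b"
      using assms b by (simp flip: power_mult_distrib)
    also have "\<dots> \<le> (real b / c) ^ b * (1 + c * y\<^sup>2 / real b) ^ b"
      using assms by (intro mult_left_mono power_mono) auto
    also have "(1 + c * y\<^sup>2 / real b) ^ b \<le> exp (c * y\<^sup>2)"
      using assms b by (intro exp_ge_one_plus_x_over_n_power_n) (auto intro: order_trans[of _ 0])
    finally have "y ^ b \<le> (real b / c) ^ b * exp (c * y\<^sup>2)" using P by (simp add: mult_left_mono)
    also have "\<dots> \<le> (1 + (real b / c) ^ b) * exp (c * y\<^sup>2)"
      by (intro mult_right_mono) auto
    finally show ?thesis .
  qed
qed

text \<open>The measure \<open>exp (- c * s * \<bar>x\<bar>\<^sup>2) dx\<close> on the ball of radius \<open>L\<close> lives at length scale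
\<open>min L (1 / sqrt s)\<close>: either the ball or the Gaussian confines it. All uniformity in \<open>s\<close> and \<open>L\<close>
below is expressed through this scale.\<close>

lemma ball_moment_bound:
  fixes c :: real
  assumes "c > 0"
  obtains C where "C \<ge> 0"
    "\<And>s L. s > 0 \<Longrightarrow> L > 0 \<Longrightarrow>
      (LINT x:cball (0::'a::euclidean_space) L|lborel. norm x ^ b * exp (- c * s * (norm x)\<^sup>2))
      \<le> C * min L (1 / sqrt s) ^ (DIM('a) + b)"
proof -
  obtain D where D: "D \<ge> 0" "\<And>y. y \<ge> 0 \<Longrightarrow> y ^ b \<le> D * exp (c / 2 * y\<^sup>2)"
    using power_le_exp_square[of "c/2" b] assms by auto
  define V where "V = unit_ball_vol (real DIM('a))"
  define W where "W = D * sqrt (2 * pi / c) ^ DIM('a)"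
  show ?thesis
  proof
    show "max V W \<ge> 0" unfolding V_def W_def by (simp add: max.coboundedI1)
    fix s L :: real assume s: "s > 0" and L: "L > 0"
    let ?f = "\<lambda>x::'a. norm x ^ b * exp (- c * s * (norm x)\<^sup>2)"
    have i: "set_integrable lborel (cball 0 L) ?f"
      unfolding set_integrable_def by (rule borel_integrable_compact) (auto intro!: continuous_intros)
    have "(LINT x:cball 0 L|lborel. ?f x) \<le> (LINT x:cball (0::'a) L|lborel. L ^ b)"
    proof (rule set_integral_mono[OF i])
      show "set_integrable lborel (cball (0::'a) L) (\<lambda>x. L ^ b)"
        unfolding set_integrable_def by (rule borel_integrable_compact) auto
      fix x :: 'a assume "x \<in> cball 0 L"
      then have "norm x ^ b * exp (- c * s * (norm x)\<^sup>2) \<le> L ^ b * 1"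
        using assms s L by (intro mult_mono power_mono) auto
      then show "?f x \<le> L ^ b" by simp
    qed
    also have "\<dots> = V * L ^ (DIM('a) + b)"
      using L by (simp add: V_def set_lebesgue_integral_def content_cball power_add mult.commute mult.left_commute)
    finally have 1: "(LINT x:cball 0 L|lborel. ?f x) \<le> V * L ^ (DIM('a) + b)" .
    have pt: "?f x \<le> D * (1 / sqrt s) ^ b * exp (- (c / 2 * s) * (norm x)\<^sup>2)" for x :: 'a
    proof -
      have "norm x ^ b = (1 / sqrt s) ^ b * (sqrt s * norm x) ^ b"
        using s by (simp flip: power_mult_distrib)
      also have "\<dots> \<le> (1 / sqrt s) ^ b * (D * exp (c / 2 * (sqrt s * norm x)\<^sup>2))"
        using s by (intro mult_left_mono D) auto
      finally have "?f x \<le> (1 / sqrt s) ^ b * (D * exp (c / 2 * (sqrt s * norm x)\<^sup>2)) * exp (- c * s * (norm x)\<^sup>2)"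
        by (intro mult_right_mono) auto
      also have "\<dots> = D * (1 / sqrt s) ^ b * (exp (c / 2 * (sqrt s * norm x)\<^sup>2) * exp (- c * s * (norm x)\<^sup>2))"
        by (simp add: mult_ac)
      also have "exp (c / 2 * (sqrt s * norm x)\<^sup>2) * exp (- c * s * (norm x)\<^sup>2) = exp (- (c / 2 * s) * (norm x)\<^sup>2)"
      proof -
        have "c / 2 * (sqrt s * norm x)\<^sup>2 + - c * s * (norm x)\<^sup>2 = - (c / 2 * s) * (norm x)\<^sup>2"
          using s by (simp add: power_mult_distrib)
        then show ?thesis unfolding exp_add[symmetric] by simp
      qed
      finally show ?thesis .
    qed
    have c2: "c / 2 * s > 0" using assms s by simp
    have "(LINT x:cball 0 L|lborel. ?f x) \<le> (LINT x::'a|lborel. D * (1 / sqrt s) ^ b * exp (- (c / 2 * s) * (norm x)\<^sup>2))"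
      unfolding set_lebesgue_integral_def
    proof (rule integral_mono)
      show "integrable lborel (\<lambda>x. indicat_real (cball 0 L) x *\<^sub>R ?f x)"
        using i by (simp add: set_integrable_def)
      show "integrable lborel (\<lambda>x::'a. D * (1 / sqrt s) ^ b * exp (- (c / 2 * s) * (norm x)\<^sup>2))"
        by (intro integrable_mult_right gaussian_integral(1) c2)
      fix x :: 'a
      show "indicat_real (cball 0 L) x *\<^sub>R ?f x \<le> D * (1 / sqrt s) ^ b * exp (- (c / 2 * s) * (norm x)\<^sup>2)"
        using pt[of x] D(1) s by (cases "x \<in> cball 0 L") (auto intro!: mult_nonneg_nonneg)
    qed
    also have "\<dots> = D * (1 / sqrt s) ^ b * sqrt (pi / (c / 2 * s)) ^ DIM('a)"
      by (subst integral_mult_right_zero) (subst gaussian_integral(2)[OF c2], rule refl)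
    also have "sqrt (pi / (c / 2 * s)) = sqrt (2 * pi / c) * (1 / sqrt s)"
    proof -
      have "pi / (c / 2 * s) = 2 * pi / c * (1 / s)" using assms s by simp
      then show ?thesis by (metis real_sqrt_mult real_sqrt_divide real_sqrt_one)
    qed
    also have "D * (1 / sqrt s) ^ b * (sqrt (2 * pi / c) * (1 / sqrt s)) ^ DIM('a) = W * (1 / sqrt s) ^ (DIM('a) + b)"
      unfolding W_def power_mult_distrib power_add by (simp add: mult_ac)
    finally have 2: "(LINT x:cball 0 L|lborel. ?f x) \<le> W * (1 / sqrt s) ^ (DIM('a) + b)" .
    show "(LINT x:cball 0 L|lborel. ?f x) \<le> max V W * min L (1 / sqrt s) ^ (DIM('a) + b)"
    proof (cases "L \<le> 1 / sqrt s")
      case True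
      have "V * L ^ (DIM('a) + b) \<le> max V W * L ^ (DIM('a) + b)"
        using L by (intro mult_right_mono) auto
      then show ?thesis using 1 True by (simp add: min_absorb1)
    next
      case False
      have "W * (1 / sqrt s) ^ (DIM('a) + b) \<le> max V W * (1 / sqrt s) ^ (DIM('a) + b)"
        using s by (intro mult_right_mono) auto
      then show ?thesis using 2 False by (simp add: min_absorb2)
    qed
  qed
qed

section \<open>Oscillatory heat integrals with a cutoff\<close>

lemma integrable_bounded_support:
  fixes f :: "'a::euclidean_space \<Rightarrow> 'b::{banach,second_countable_topology}"
  assumes "f \<in> borel_measurable borel" "\<And>x. norm (f x) \<le> B" "\<And>x. norm x > R \<Longrightarrow> f x = 0"
  shows "integrable lborel f"
proof (rule Bochner_Integration.integrable_bound)
  show "integrable lborel (\<lambda>x::'a. indicator (cball 0 R) x *\<^sub>R B)"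
    by (intro integrable_scaleR_left integrable_real_indicator) (auto simp: emeasure_lborel_cball_finite[unfolded infinity_ennreal_def])
  show "AE x in lborel. norm (f x) \<le> norm (indicator (cball 0 R) x *\<^sub>R B)"
  proof (rule AE_I2)
    fix x show "norm (f x) \<le> norm (indicator (cball 0 R) x *\<^sub>R B)"
      using assms(2)[of x] assms(3)[of x] by (cases "norm x \<le> R") auto
  qed
qed (use assms in auto)

lemma continuous_bounded_support_bounded:
  fixes f :: "'a::euclidean_space \<Rightarrow> 'b::real_normed_vector"
  assumes "continuous_on UNIV f" "\<And>x. norm x > R \<Longrightarrow> f x = 0"
  obtains B where "B \<ge> 0" "\<And>x. norm (f x) \<le> B"
proof -
  have "bounded (f ` cball 0 R)"
    by (intro compact_imp_bounded compact_continuous_image continuous_on_subset[OF assms(1)]) auto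
  then obtain B where B: "B > 0" "\<And>x. x \<in> cball 0 R \<Longrightarrow> norm (f x) \<le> B"
    unfolding bounded_pos by auto
  show ?thesis
  proof
    show "B \<ge> 0" using B by simp
    show "norm (f x) \<le> B" for x
      using B(1) B(2)[of x] assms(2)[of x] by (cases "norm x \<le> R") auto
  qed
qed

text \<open>Integration by parts in a single direction of a Euclidean space, without iterated integrals: difference
quotients of \<open>h\<close> along \<open>v\<close> have integral zero because Lebesgue measure is translation invariant, and
they converge boundedly to the derivative on a fixed ball.\<close>

lemma integral_directional_derivative_eq_0:
  fixes h :: "'a::euclidean_space \<Rightarrow> complex"
  assumes deriv: "\<And>x. (h has_derivative D x) (at x)"
    and cont: "continuous_on UNIV (\<lambda>x. D x v)"
    and supp: "\<And>x. norm x > R \<Longrightarrow> h x = 0"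
  shows "(LINT x|lborel. D x v) = 0"
proof -
  have hc: "continuous_on UNIV h"
    using deriv by (intro differentiable_imp_continuous_on) (auto simp: differentiable_on_def differentiable_def intro: has_derivative_at_withinI)
  have [measurable]: "h \<in> borel_measurable borel"
    using hc by (rule borel_measurable_continuous_onI)
  have Dsupp: "D x v = 0" if "norm x > R" for x
  proof -
    have "((\<lambda>x. 0) has_derivative D x) (at x)"
      using deriv[of x]
    proof (rule has_derivative_transform_within_open)
      show "open {y::'a. R < norm y}" by (intro open_Collect_less continuous_intros)
    qed (use that supp in auto)
    then have "D x = (\<lambda>_. 0)" by (metis has_derivative_const has_derivative_unique)
    then show ?thesis by simp
  qed
  obtain B where B: "B \<ge> 0" "\<And>x. norm (D x v) \<le> B"
    using continuous_bounded_support_bounded[OF cont Dsupp] by metis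
  obtain K where K: "K \<ge> 0" "\<And>x. norm (h x) \<le> K"
    using continuous_bounded_support_bounded[OF hc supp] by metis
  have hi: "integrable lborel h" using K supp by (intro integrable_bounded_support) auto
  define e where "e n = 1 / real (Suc n)" for n
  have e: "e n > 0" "e n \<le> 1" for n by (auto simp: e_def)
  define q where "q n x = (h (e n *\<^sub>R v + x) - h x) /\<^sub>R e n" for n x
  have tr: "integrable lborel (\<lambda>x. h (w + x))" "(LINT x|lborel. h (w + x)) = integral\<^sup>L lborel h" for w
  proof -
    have "integrable (distr lborel borel ((+) w)) h" using hi by (simp add: lborel_distr_plus)
    then show "integrable lborel (\<lambda>x. h (w + x))" by (subst (asm) integrable_distr_eq) auto
    have "integral\<^sup>L (distr lborel borel ((+) w)) h = (LINT x|lborel. h (w + x))"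
      by (rule integral_distr) auto
    then show "(LINT x|lborel. h (w + x)) = integral\<^sup>L lborel h" by (simp add: lborel_distr_plus)
  qed
  have q0: "integral\<^sup>L lborel (q n) = 0" for n
    unfolding q_def using tr hi by simp
  have qlim: "(\<lambda>n. q n x) \<longlonglongrightarrow> D x v" for x
  proof -
    have "((\<lambda>t. h (t *\<^sub>R v + x)) has_derivative (\<lambda>t. D x (t *\<^sub>R v))) (at 0)"
      by (rule has_derivative_compose[of "\<lambda>t. t *\<^sub>R v + x" "\<lambda>t. t *\<^sub>R v" 0 UNIV h "D x"])
         (auto intro!: derivative_eq_intros deriv)
    then have "((\<lambda>t. norm (h (t *\<^sub>R v + x) - h x - D x (t *\<^sub>R v)) / norm t) \<longlongrightarrow> 0) (at 0)"
      unfolding has_derivative_iff_norm by simp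
    moreover have "filterlim e (at 0) sequentially"
      unfolding e_def by real_asymp
    ultimately have "(\<lambda>n. norm (h (e n *\<^sub>R v + x) - h x - D x (e n *\<^sub>R v)) / norm (e n)) \<longlonglongrightarrow> 0"
      by (rule filterlim_compose)
    moreover have "norm (h (e n *\<^sub>R v + x) - h x - D x (e n *\<^sub>R v)) / norm (e n) = norm (q n x - D x v)" for n
    proof -
      have "D x (e n *\<^sub>R v) = e n *\<^sub>R D x v"
        using deriv[of x] by (simp add: has_derivative_linear linear_scale)
      then have "q n x - D x v = (h (e n *\<^sub>R v + x) - h x - D x (e n *\<^sub>R v)) /\<^sub>R e n"
        using e(1)[of n] unfolding q_def by (simp add: scaleR_diff_right)
      then show ?thesis using e(1)[of n] by (simp add: divide_inverse mult.commute)
    qed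
    ultimately show ?thesis by (simp add: tendsto_norm_zero_iff LIM_zero_iff)
  qed
  have qbd: "norm (q n x) \<le> indicator (cball 0 (R + norm v)) x *\<^sub>R B" for n x
  proof (cases "norm x \<le> R + norm v")
    case False
    have "norm x \<le> norm (e n *\<^sub>R v + x) + norm (e n *\<^sub>R v)"
      by (metis add_diff_cancel_left' norm_minus_commute norm_triangle_sub add.commute)
    moreover have "norm (e n *\<^sub>R v) \<le> norm v" using e[of n] by (simp add: mult_left_le_one_le)
    ultimately have "norm (e n *\<^sub>R v + x) > R" "norm x > R" using False by (auto intro: order.strict_trans1[of _ "R + norm v"])
    then show ?thesis using False by (simp add: q_def supp)
  next
    case True
    \<comment> \<open>The mean value inequality along the segment from \<open>x\<close> to \<open>x + e n *\<^sub>R v\<close> bounds the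
      difference quotient by the supremum of the derivative, uniformly in \<open>n\<close>.\<close>
    have "\<exists>t\<in>{0<..<e n}. norm (h (e n *\<^sub>R v + x) - h (0 *\<^sub>R v + x)) \<le> norm (D (t *\<^sub>R v + x) ((e n - 0) *\<^sub>R v))"
    proof (rule mvt_general[of 0 "e n" "\<lambda>t. h (t *\<^sub>R v + x)" "\<lambda>t s. D (t *\<^sub>R v + x) (s *\<^sub>R v)"])
      show "continuous_on {0..e n} (\<lambda>t. h (t *\<^sub>R v + x))"
        by (rule continuous_on_compose2[OF hc]) (auto intro!: continuous_intros)
      show "((\<lambda>t. h (t *\<^sub>R v + x)) has_derivative (\<lambda>s. D (t *\<^sub>R v + x) (s *\<^sub>R v))) (at t)" for t
        by (rule has_derivative_compose[of "\<lambda>t. t *\<^sub>R v + x" "\<lambda>t. t *\<^sub>R v" t UNIV h])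
           (auto intro!: derivative_eq_intros deriv)
    qed (rule e)
    then obtain t where "norm (h (e n *\<^sub>R v + x) - h x) \<le> norm (D (t *\<^sub>R v + x) (e n *\<^sub>R v))" by auto
    also have "D (t *\<^sub>R v + x) (e n *\<^sub>R v) = e n *\<^sub>R D (t *\<^sub>R v + x) v"
      using deriv[of "t *\<^sub>R v + x"] by (simp add: has_derivative_linear linear_scale)
    also have "norm \<dots> \<le> e n * B" using e(1)[of n] B(2) by simp
    finally have "norm (h (e n *\<^sub>R v + x) - h x) / e n \<le> B"
      using e(1)[of n] by (simp add: pos_divide_le_eq mult.commute)
    moreover have "norm (q n x) = norm (h (e n *\<^sub>R v + x) - h x) / e n"
      using e(1)[of n] unfolding q_def norm_scaleR by (simp add: divide_inverse mult.commute)
    ultimately show ?thesis using True by simp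
  qed
  have "(\<lambda>n. integral\<^sup>L lborel (q n)) \<longlonglongrightarrow> (LINT x|lborel. D x v)"
  proof (rule integral_dominated_convergence)
    show "(\<lambda>x. D x v) \<in> borel_measurable lborel"
      using borel_measurable_continuous_onI[OF cont] by simp
    show "integrable lborel (\<lambda>x::'a. indicator (cball 0 (R + norm v)) x *\<^sub>R B)"
      by (intro integrable_scaleR_left integrable_real_indicator) (auto simp: emeasure_lborel_cball_finite[unfolded infinity_ennreal_def])
    show "q n \<in> borel_measurable lborel" for n unfolding q_def by measurable
  qed (use qlim qbd in auto)
  then show ?thesis by (simp add: q0 LIMSEQ_const_iff)
qed

lemma Ck_continuous: "Ck k f \<Longrightarrow> continuous_on UNIV f"
  by (cases k) (auto intro!: differentiable_imp_continuous_on simp: differentiable_on_def differentiable_at_withinI)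

lemma Ck_Suc_imp_Ck: "Ck (Suc k) f \<Longrightarrow> Ck k f"
proof (induction k arbitrary: f)
  case 0
  then show ?case using Ck_continuous[of "Suc 0" f] by simp
next
  case (Suc k)
  then show ?case by (metis Ck.simps(2))
qed

text \<open>One factor \<open>s * R\<^sup>2 \<le> 1\<close> lowers the exponent of \<open>R\<close> by two; this is how the terms produced by
differentiating the heat factor fit into the decay estimates.\<close>

lemma powr_shift_two: "(R::real) > 0 \<Longrightarrow> R powr (p + 1) = R\<^sup>2 * R powr (p - 1)"
  using powr_add[of R 2 "p - 1"] by (simp add: powr_numeral algebra_simps)

text \<open>With \<open>b = 0\<close> and \<open>f\<close> the cutoff this is the heat regularisation of the integral in \<open>A_trunc\<close>; the
weight \<open>(w \<bullet> x) ^ b\<close> appears when integrating by parts in the direction \<open>w\<close>.\<close>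

definition cutoff_gaussian_fourier ::
    "'a::euclidean_space \<Rightarrow> ('a \<Rightarrow> complex) \<Rightarrow> nat \<Rightarrow> real \<Rightarrow> real \<Rightarrow> complex" where
  "cutoff_gaussian_fourier w f b s N = (LINT x|lborel. f (x /\<^sub>R N) *
     complex_of_real ((w \<bullet> x) ^ b * exp (- s * (norm x)\<^sup>2)) * exp (\<i> * complex_of_real (w \<bullet> x)))"

lemma cutoff_gaussian_fourier_integrable:
  fixes w :: "'a::euclidean_space"
  assumes "continuous_on UNIV f" "\<And>x. norm x > 1 \<Longrightarrow> f x = 0" "N > 0"
  shows "integrable lborel (\<lambda>x. f (x /\<^sub>R N) *
     complex_of_real ((w \<bullet> x) ^ b * exp (- s * (norm x)\<^sup>2)) * exp (\<i> * complex_of_real (w \<bullet> x)))"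
    (is "integrable lborel ?g")
proof -
  have c: "continuous_on UNIV ?g"
    by (intro continuous_intros continuous_on_compose2[OF assms(1)]) auto
  have z: "?g x = 0" if "norm x > N" for x
    using that assms(3) by (subst assms(2)) (auto simp: field_simps)
  obtain B where "\<And>x. norm (?g x) \<le> B"
    using continuous_bounded_support_bounded[OF c z] by metis
  then show ?thesis
    using borel_measurable_continuous_onI[OF c] z by (intro integrable_bounded_support) auto
qed

text \<open>Differentiating the integrand along \<open>w\<close> reproduces integrals of the same kind: the cutoff contributes its
own derivative with a factor \<open>1 / N\<close>, the monomial loses a degree, the Gaussian raises the degree with
a factor \<open>2 * s\<close>, and the exponential contributes \<open>\<i>\<close> because \<open>w\<close> is a unit vector. The family is kept
closed by allowing the weight \<open>(w \<bullet> x) ^ b\<close>; at \<open>b = 0\<close>, where \<open>b - 1\<close> is truncated, the term of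
lower degree has coefficient \<open>0\<close>.\<close>

lemma cutoff_gaussian_fourier_by_parts:
  fixes w :: "'a::euclidean_space"
  assumes w: "norm w = 1" and f: "Ck (Suc m) f" and supp: "\<And>x. norm x > 1 \<Longrightarrow> f x = 0" and N: "N > 0"
  defines "f' \<equiv> \<lambda>x. frechet_derivative f (at x) w"
  shows "cutoff_gaussian_fourier w f' b s N / of_real N
      + of_nat b * cutoff_gaussian_fourier w f (b - 1) s N
      - of_real (2 * s) * cutoff_gaussian_fourier w f (b + 1) s N
      + \<i> * cutoff_gaussian_fourier w f b s N = 0"
    and "\<And>x. norm x > 1 \<Longrightarrow> f' x = 0"
proof -
  have fd: "(f has_derivative frechet_derivative f (at x)) (at x)" for x
    using f by (simp add: frechet_derivative_works)
  have lin: "linear (frechet_derivative f (at x))" for x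
    using fd by (rule has_derivative_linear)
  have fc: "continuous_on UNIV f" using f by (rule Ck_continuous)
  have f'c: "continuous_on UNIV f'" using f unfolding f'_def by (auto intro: Ck_continuous)
  show f'supp: "f' x = 0" if "norm x > 1" for x
  proof -
    have "((\<lambda>x. 0) has_derivative frechet_derivative f (at x)) (at x)"
      using fd[of x]
    proof (rule has_derivative_transform_within_open)
      show "open {y::'a. 1 < norm y}" by (intro open_Collect_less continuous_intros)
    qed (use that supp in auto)
    then have "frechet_derivative f (at x) = (\<lambda>_. 0)" by (metis has_derivative_const has_derivative_unique)
    then show ?thesis by (simp add: f'_def)
  qed
  define g where "g f b x = f (x /\<^sub>R N) *
     complex_of_real ((w \<bullet> x) ^ b * exp (- s * (norm x)\<^sup>2)) * exp (\<i> * complex_of_real (w \<bullet> x))"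
    for f :: "'a \<Rightarrow> complex" and b x
  define P' where "P' x v = real b * (w \<bullet> x) ^ (b - 1) * (w \<bullet> v) * exp (- s * (x \<bullet> x))
      - (w \<bullet> x) ^ b * exp (- s * (x \<bullet> x)) * (2 * s * (x \<bullet> v))" for x v
  define D where "D x v = frechet_derivative f (at (x /\<^sub>R N)) (v /\<^sub>R N) *
     complex_of_real ((w \<bullet> x) ^ b * exp (- s * (norm x)\<^sup>2)) * exp (\<i> * complex_of_real (w \<bullet> x))
     + f (x /\<^sub>R N) * complex_of_real (P' x v) * exp (\<i> * complex_of_real (w \<bullet> x))
     + f (x /\<^sub>R N) * complex_of_real ((w \<bullet> x) ^ b * exp (- s * (norm x)\<^sup>2)) * (\<i> * complex_of_real (w \<bullet> v) * exp (\<i> * complex_of_real (w \<bullet> x)))" for x v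
  have der: "(g f b has_derivative D x) (at x)" for x
  proof -
    have 1: "((\<lambda>x. f (x /\<^sub>R N)) has_derivative (\<lambda>v. frechet_derivative f (at (x /\<^sub>R N)) (v /\<^sub>R N))) (at x)"
      by (rule has_derivative_compose[OF _ fd]) (auto intro!: derivative_eq_intros)
    have 2: "((\<lambda>x. (w \<bullet> x) ^ b * exp (- s * (x \<bullet> x))) has_derivative P' x) (at x)"
      unfolding P'_def
      by (auto intro!: derivative_eq_intros ext simp: inner_commute algebra_simps)
    have 3: "((\<lambda>x. exp (\<i> * complex_of_real (w \<bullet> x))) has_derivative
      (\<lambda>v. \<i> * complex_of_real (w \<bullet> v) * exp (\<i> * complex_of_real (w \<bullet> x)))) (at x)"
      by (rule has_derivative_compose[of "\<lambda>x. \<i> * complex_of_real (w \<bullet> x)" "\<lambda>v. \<i> * complex_of_real (w \<bullet> v)" x UNIV exp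
            "\<lambda>z. z * exp (\<i> * complex_of_real (w \<bullet> x))"])
         (auto intro!: derivative_eq_intros simp: has_field_derivative_def[symmetric] mult.commute[of _ "exp _"])
    show ?thesis
      unfolding g_def
      by (rule has_derivative_eq_rhs[OF has_derivative_mult[OF has_derivative_mult[OF 1 has_derivative_of_real[OF 2]] 3, folded power2_norm_eq_inner]])
         (auto simp: D_def power2_norm_eq_inner algebra_simps)
  qed
  have Dw: "D x w = g f' b x / of_real N + of_nat b * g f (b - 1) x - of_real (2 * s) * g f (b + 1) x + \<i> * g f b x" for x
    using w unfolding D_def g_def P'_def f'_def linear_scale[OF lin]
    by (simp add: power2_norm_eq_inner[symmetric] inner_commute[of x w] scaleR_conv_of_real field_simps)
  have "(LINT x|lborel. D x w) = 0"
  proof (rule integral_directional_derivative_eq_0[OF der])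
    show "continuous_on UNIV (\<lambda>x. D x w)"
      unfolding Dw g_def using N
      by (intro continuous_intros continuous_on_compose2[OF fc] continuous_on_compose2[OF f'c]) auto
    show "g f b x = 0" if "norm x > N" for x
      using that N unfolding g_def by (subst supp) (auto simp: field_simps)
  qed
  moreover have "integrable lborel (g f b)" for b
    unfolding g_def by (intro cutoff_gaussian_fourier_integrable fc supp N)
  moreover have "integrable lborel (g f' b)"
    unfolding g_def by (intro cutoff_gaussian_fourier_integrable f'c f'supp N)
  ultimately show "cutoff_gaussian_fourier w f' b s N / of_real N
      + of_nat b * cutoff_gaussian_fourier w f (b - 1) s N
      - of_real (2 * s) * cutoff_gaussian_fourier w f (b + 1) s N
      + \<i> * cutoff_gaussian_fourier w f b s N = 0"
    unfolding cutoff_gaussian_fourier_def g_def[symmetric] Dw by simp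
qed

text \<open>At scale \<open>R\<close> the absolute integral has size \<open>R powr (d + b)\<close>. In the recursion of
\<open>cutoff_gaussian_fourier_by_parts\<close> each of the three terms is smaller by \<open>1 / R\<close>: \<open>1 / N \<le> 1 / R\<close>, a lower
degree is one power of \<open>R\<close>, and \<open>s * R\<^sup>2 \<le> 1\<close>. So \<open>m\<close> derivatives of \<open>f\<close> yield the
gain \<open>R powr - m\<close>. For \<open>b = 0\<close> and \<open>m = d\<close> the bound is uniform in \<open>s\<close> and \<open>N\<close>.\<close>

lemma cutoff_gaussian_fourier_decay:
  fixes w :: "'a::euclidean_space"
  assumes w: "norm w = 1" and f: "Ck m f" and supp: "\<And>x. norm x > 1 \<Longrightarrow> f x = 0"
  shows "\<exists>C\<ge>0. \<forall>s>0. \<forall>N>0. norm (cutoff_gaussian_fourier w f b s N)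
      \<le> C * min N (1 / sqrt s) powr (real (DIM('a) + b) - real m)"
  using f supp
proof (induction m arbitrary: f b)
  case (0 f b)
  have fc: "continuous_on UNIV f" using 0(1) by simp
  obtain K where K: "K \<ge> 0" "\<And>x. norm (f x) \<le> K"
    using continuous_bounded_support_bounded[OF fc 0(2)] by metis
  obtain C where C: "C \<ge> 0" "\<And>s L. s > 0 \<Longrightarrow> L > 0 \<Longrightarrow>
      (LINT x:cball (0::'a::euclidean_space) L|lborel. norm x ^ b * exp (- 1 * s * (norm x)\<^sup>2))
      \<le> C * min L (1 / sqrt s) ^ (DIM('a) + b)"
    using ball_moment_bound[of 1 b, where 'a='a] by auto
  show ?case
  proof (intro exI[of _ "K * C"] conjI allI impI)
    show "K * C \<ge> 0" using K C by simp
    fix s N :: real assume s: "s > 0" and N: "N > 0"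
    let ?h = "\<lambda>x::'a. norm x ^ b * exp (- 1 * s * (norm x)\<^sup>2)"
    have "norm (cutoff_gaussian_fourier w f b s N) \<le> (LINT x:cball (0::'a) N|lborel. K * ?h x)"
      unfolding cutoff_gaussian_fourier_def set_lebesgue_integral_def
    proof (rule Bochner_Integration.integral_norm_bound_integral[OF cutoff_gaussian_fourier_integrable[OF fc 0(2) N]])
      show "integrable lborel (\<lambda>x. indicator (cball (0::'a) N) x *\<^sub>R (K * ?h x))"
        by (rule borel_integrable_compact) (auto intro!: continuous_intros)
      fix x :: 'a
      show "norm (f (x /\<^sub>R N) * complex_of_real ((w \<bullet> x) ^ b * exp (- s * (norm x)\<^sup>2)) * exp (\<i> * complex_of_real (w \<bullet> x)))
        \<le> indicator (cball 0 N) x *\<^sub>R (K * ?h x)"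
      proof (cases "norm x \<le> N")
        case False
        then have "f (x /\<^sub>R N) = 0" using N by (intro 0(2)) (auto simp: field_simps)
        then show ?thesis using False by simp
      next
        case True
        have "\<bar>w \<bullet> x\<bar> \<le> norm x" using Cauchy_Schwarz_ineq2[of w x] w by simp
        then have "\<bar>w \<bullet> x\<bar> ^ b \<le> norm x ^ b" by (intro power_mono) auto
        then have "norm (f (x /\<^sub>R N)) * (\<bar>w \<bullet> x\<bar> ^ b * exp (- 1 * s * (norm x)\<^sup>2)) \<le> K * ?h x"
          using K by (intro mult_mono K(2) mult_right_mono) auto
        then show ?thesis using True by (simp add: norm_mult norm_power abs_mult)
      qed
    qed
    also have "\<dots> \<le> K * (C * min N (1 / sqrt s) ^ (DIM('a) + b))"
      unfolding set_integral_mult_right using K(1) C(2)[OF s N] by (auto intro: mult_left_mono)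
    also have "min N (1 / sqrt s) ^ (DIM('a) + b) = min N (1 / sqrt s) powr (real (DIM('a) + b) - real 0)"
      using s N by (subst powr_realpow[symmetric]) auto
    finally show "norm (cutoff_gaussian_fourier w f b s N) \<le> K * C * min N (1 / sqrt s) powr (real (DIM('a) + b) - real 0)"
      by (simp add: mult.assoc)
  qed
next
  case (Suc m f b)
  define f' where "f' x = frechet_derivative f (at x) w" for x
  have f: "Ck m f" using Suc.prems(1) by (rule Ck_Suc_imp_Ck)
  have f': "Ck m f'" using Suc.prems(1) unfolding f'_def by simp
  have f'supp: "f' x = 0" if "norm x > 1" for x
    unfolding f'_def using cutoff_gaussian_fourier_by_parts(2)[OF w Suc.prems zero_less_one that] .
  let ?R = "\<lambda>s N. min N (1 / sqrt s)" and ?d = "real DIM('a)"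
  obtain C1 where C1: "C1 \<ge> 0" "\<And>s N. s > 0 \<Longrightarrow> N > 0 \<Longrightarrow> norm (cutoff_gaussian_fourier w f' b s N)
      \<le> C1 * ?R s N powr (real (DIM('a) + b) - real m)" using Suc.IH[OF f' f'supp, of b] by blast
  obtain C2 where C2: "C2 \<ge> 0" "\<And>s N. s > 0 \<Longrightarrow> N > 0 \<Longrightarrow> norm (cutoff_gaussian_fourier w f (b - 1) s N)
      \<le> C2 * ?R s N powr (real (DIM('a) + (b - 1)) - real m)" using Suc.IH[OF f Suc.prems(2), of "b - 1"] by blast
  obtain C3 where C3: "C3 \<ge> 0" "\<And>s N. s > 0 \<Longrightarrow> N > 0 \<Longrightarrow> norm (cutoff_gaussian_fourier w f (b + 1) s N)
      \<le> C3 * ?R s N powr (real (DIM('a) + (b + 1)) - real m)" using Suc.IH[OF f Suc.prems(2), of "b + 1"] by blast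
  show ?case
  proof (intro exI[of _ "C1 + real b * C2 + 2 * C3"] conjI allI impI)
    show "C1 + real b * C2 + 2 * C3 \<ge> 0" using C1 C2 C3 by simp
    fix s N :: real assume s: "s > 0" and N: "N > 0"
    define R where "R = ?R s N"
    define p where "p = real (DIM('a) + b) - real m"
    have R: "R > 0" "R \<le> N" "R \<le> 1 / sqrt s" using s N by (auto simp: R_def)
    have "R\<^sup>2 \<le> (1 / sqrt s)\<^sup>2" using R by (intro power_mono) auto
    then have sR: "s * R\<^sup>2 \<le> 1" using s by (simp add: power_divide field_simps)
    have N1: "R powr p / N \<le> R powr (p - 1)"
      using R N by (simp add: powr_diff frac_le)
    have S1: "s * R powr (p + 1) \<le> R powr (p - 1)"
      using mult_right_mono[OF sR, of "R powr (p - 1)"] R(1) by (simp add: powr_shift_two mult.assoc)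
    let ?A = "cutoff_gaussian_fourier w f' b s N / of_real N"
    let ?B = "of_nat b * cutoff_gaussian_fourier w f (b - 1) s N"
    let ?C = "of_real (2 * s) * cutoff_gaussian_fourier w f (b + 1) s N"
    have "\<i> * cutoff_gaussian_fourier w f b s N = ?C - ?A - ?B"
      using cutoff_gaussian_fourier_by_parts(1)[OF w Suc.prems N, of b s] unfolding f'_def
      by (simp add: algebra_simps eq_neg_iff_add_eq_0)
    then have "norm (cutoff_gaussian_fourier w f b s N) = norm (?C - ?A - ?B)"
      by (metis mult_1 norm_ii norm_mult)
    also have "\<dots> \<le> norm ?A + norm ?B + norm ?C"
      using norm_triangle_ineq4[of "?C - ?A" ?B] norm_triangle_ineq4[of ?C ?A] by simp
    also have "norm ?A \<le> C1 * R powr (p - 1)"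
    proof -
      have "norm ?A \<le> C1 * R powr p / N"
        using C1(2)[OF s N] N unfolding R_def p_def by (simp add: norm_divide divide_right_mono)
      also have "\<dots> \<le> C1 * R powr (p - 1)" using mult_left_mono[OF N1 C1(1)] by simp
      finally show ?thesis .
    qed
    also have "norm ?B \<le> real b * C2 * R powr (p - 1)"
    proof (cases "b = 0")
      case False
      then have "real (DIM('a) + (b - 1)) - real m = p - 1" by (simp add: p_def of_nat_diff)
      then have "norm (cutoff_gaussian_fourier w f (b - 1) s N) \<le> C2 * R powr (p - 1)"
        using C2(2)[OF s N] unfolding R_def by simp
      from mult_left_mono[OF this, of "real b"] show ?thesis by (simp add: norm_mult mult.assoc)
    qed simp
    also have "norm ?C \<le> 2 * C3 * R powr (p - 1)"
    proof -
      have pp: "real (DIM('a) + (b + 1)) - real m = p + 1" by (simp add: p_def)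
      have "norm ?C \<le> 2 * s * (C3 * R powr (p + 1))"
        using C3(2)[OF s N] s unfolding pp R_def[symmetric] by (simp add: norm_mult mult_left_mono)
      also have "\<dots> = 2 * C3 * (s * R powr (p + 1))" by simp
      also have "\<dots> \<le> 2 * C3 * R powr (p - 1)" using C3(1) by (intro mult_left_mono S1) auto
      finally show ?thesis .
    qed
    finally show "norm (cutoff_gaussian_fourier w f b s N)
      \<le> (C1 + real b * C2 + 2 * C3) * min N (1 / sqrt s) powr (real (DIM('a) + b) - real (Suc m))"
      by (simp add: R_def p_def algebra_simps)
  qed
qed

section \<open>Oscillatory heat integrals on the circle\<close>

text \<open>Jordan's inequality \<open>sin x \<ge> 2 * x / pi\<close> on \<open>[0, pi / 2]\<close>, from concavity of the sine, together with
\<open>2 - 2 * cos \<theta> = 4 * (sin (\<theta> / 2))\<^sup>2\<close>.\<close>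

lemma two_minus_two_cos_lower_bound:
  assumes "\<bar>\<theta>\<bar> \<le> pi"
  shows "4 / pi\<^sup>2 * \<theta>\<^sup>2 \<le> 2 - 2 * cos \<theta>"
proof -
  have cv: "convex_on {0..pi/2} (\<lambda>x. - sin x)"
  proof (rule f''_ge0_imp_convex)
    show "((\<lambda>x. - sin x) has_real_derivative - cos x) (at x)" for x :: real
      by (auto intro!: derivative_eq_intros)
    show "((\<lambda>x. - cos x) has_real_derivative sin x) (at x)" for x :: real
      by (auto intro!: derivative_eq_intros)
    show "0 \<le> sin x" if "x \<in> {0..pi/2}" for x :: real
      using that by (intro sin_ge_zero) auto
  qed auto
  have J: "2 / pi * x \<le> sin x" if "0 \<le> x" "x \<le> pi / 2" for x :: real
    using convex_onD[OF cv, of "2 / pi * x" 0 "pi/2"] that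
    by (simp add: field_simps)
  have "2 / pi * (\<bar>\<theta>\<bar> / 2) \<le> sin (\<bar>\<theta>\<bar> / 2)" by (rule J) (use assms in auto)
  then have "(2 / pi * (\<bar>\<theta>\<bar> / 2))\<^sup>2 \<le> (sin (\<bar>\<theta>\<bar> / 2))\<^sup>2"
    by (intro power_mono) auto
  moreover have "cos \<theta> = 1 - 2 * (sin (\<bar>\<theta>\<bar> / 2))\<^sup>2"
    using cos_double_sin[of "\<bar>\<theta>\<bar> / 2"] by simp
  ultimately show ?thesis by (simp add: power_mult_distrib power_divide)
qed

text \<open>For \<open>b = c = 0\<close> this is \<open>2 * pi\<close> times the heat kernel at time \<open>s\<close> of the one-dimensional lattice.\<close>

definition torus_heat_fourier :: "nat \<Rightarrow> nat \<Rightarrow> real \<Rightarrow> int \<Rightarrow> complex" where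
  "torus_heat_fourier b c s k = (LINT \<theta>:{- pi..pi}|lborel.
     complex_of_real (sin \<theta> ^ b * cos \<theta> ^ c * exp (- s * (2 - 2 * cos \<theta>))) *
     exp (\<i> * complex_of_real (of_int k * \<theta>)))"

lemma torus_heat_fourier_integrable:
  "set_integrable lborel {- pi..pi} (\<lambda>\<theta>.
     complex_of_real (sin \<theta> ^ b * cos \<theta> ^ c * exp (- s * (2 - 2 * cos \<theta>))) *
     exp (\<i> * complex_of_real (of_int k * \<theta>)))"
  unfolding set_integrable_def by (rule borel_integrable_compact) (auto intro!: continuous_intros)

text \<open>As in \<open>cutoff_gaussian_fourier_by_parts\<close>; the boundary terms cancel by periodicity, which is where the
integrality of the frequency \<open>k\<close> is used. Powers of the sine play the role of the monomials, and
powers of the cosine are carried along to close the family under differentiation.\<close>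

lemma torus_heat_fourier_by_parts:
  "of_nat b * torus_heat_fourier (b - 1) (c + 1) s k
     - of_nat c * torus_heat_fourier (b + 1) (c - 1) s k
     - of_real (2 * s) * torus_heat_fourier (b + 1) c s k
     + \<i> * of_int k * torus_heat_fourier b c s k = 0"
proof -
  define P where "P b c \<theta> = sin \<theta> ^ b * cos \<theta> ^ c * exp (- s * (2 - 2 * cos \<theta>))" for b c \<theta>
  define E where "E \<theta> = exp (\<i> * complex_of_real (of_int k * \<theta>))" for \<theta>
  define g where "g b c \<theta> = complex_of_real (P b c \<theta>) * E \<theta>" for b c \<theta>
  define g' where "g' \<theta> = of_nat b * g (b - 1) (c + 1) \<theta> - of_nat c * g (b + 1) (c - 1) \<theta>
     - of_real (2 * s) * g (b + 1) c \<theta> + \<i> * of_int k * g b c \<theta>" for \<theta>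
  define G where "G b c \<theta> = indicat_real {- pi..pi} \<theta> *\<^sub>R g b c \<theta>" for b c \<theta>
  have der: "(g b c has_vector_derivative g' \<theta>) (at \<theta>)" for \<theta>
  proof -
    have 1: "(P b c has_real_derivative
      (real b * P (b - 1) (c + 1) \<theta> - real c * P (b + 1) (c - 1) \<theta> - 2 * s * P (b + 1) c \<theta>)) (at \<theta>)"
      unfolding P_def by (auto intro!: derivative_eq_intros simp: algebra_simps)
    have 2: "(E has_vector_derivative \<i> * of_int k * E \<theta>) (at \<theta>)"
      unfolding has_vector_derivative_def E_def
      by (rule has_derivative_compose[of "\<lambda>x. \<i> * complex_of_real (of_int k * x)" "\<lambda>v. \<i> * complex_of_real (of_int k * v)" \<theta> UNIV exp
            "\<lambda>z. z * exp (\<i> * complex_of_real (of_int k * \<theta>))", THEN has_derivative_eq_rhs])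
         (auto intro!: derivative_eq_intros simp: has_field_derivative_def[symmetric] mult.commute[of _ "exp _"] scaleR_conv_of_real)
    have "g b c = (\<lambda>x. complex_of_real (P b c x) * E x)" by (rule ext) (rule g_def)
    moreover have "complex_of_real (P b c \<theta>) * (\<i> * of_int k * E \<theta>) + complex_of_real (real b * P (b - 1) (c + 1) \<theta> - real c * P (b + 1) (c - 1) \<theta> - 2 * s * P (b + 1) c \<theta>) * E \<theta> = g' \<theta>"
      unfolding g'_def g_def by (simp add: ring_distribs mult_ac)
    ultimately show ?thesis
      using has_vector_derivative_mult[OF has_vector_derivative_of_real[OF 1] 2] by simp
  qed
  have "(LINT \<theta>|lborel. indicat_real {- pi..pi} \<theta> *\<^sub>R g' \<theta>) = g b c pi - g b c (- pi)"
  proof (rule integral_FTC_atLeastAtMost)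
    show "continuous_on {- pi..pi} g'"
      unfolding g'_def g_def P_def E_def by (intro continuous_intros)
  qed (use der in \<open>auto intro: has_vector_derivative_at_within\<close>)
  also have "\<dots> = 0"
  proof -
    have "exp (\<i> * complex_of_real (of_int k * pi)) = exp (\<i> * complex_of_real (of_int k * (- pi)))"
      unfolding cis_conv_exp[symmetric] by (simp add: complex_eq_iff mult.commute[of _ pi] sin_int_times_real)
    then show ?thesis unfolding g_def P_def E_def by (cases b) auto
  qed
  finally have z: "(LINT \<theta>|lborel. indicat_real {- pi..pi} \<theta> *\<^sub>R g' \<theta>) = 0" .
  have i: "integrable lborel (G b c)" for b c
    using torus_heat_fourier_integrable[of b c s k]
    unfolding G_def g_def P_def E_def set_integrable_def .
  have G': "indicat_real {- pi..pi} \<theta> *\<^sub>R g' \<theta> = of_nat b * G (b - 1) (c + 1) \<theta> - of_nat c * G (b + 1) (c - 1) \<theta>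
     - of_real (2 * s) * G (b + 1) c \<theta> + \<i> * of_int k * G b c \<theta>" for \<theta>
    unfolding G_def g'_def by (cases "\<theta> \<in> {- pi..pi}") auto
  have t: "torus_heat_fourier b c s k = integral\<^sup>L lborel (G b c)" for b c
    unfolding torus_heat_fourier_def set_lebesgue_integral_def G_def g_def P_def E_def ..
  show ?thesis
    using z unfolding G' t using i by simp
qed

text \<open>The one-dimensional analogue of \<open>cutoff_gaussian_fourier_decay\<close>. Only the power of the sine counts for
the scaling, by \<open>\<bar>sin \<theta>\<bar> \<le> \<bar>\<theta>\<bar>\<close>. Differentiating the cosine raises that power without a
compensating factor \<open>s\<close>, which costs nothing more than \<open>R\<^sup>2 \<le> pi\<^sup>2\<close>.\<close>

lemma torus_heat_fourier_decay:
  "\<exists>C\<ge>0. \<forall>s>0. \<forall>k. \<bar>real_of_int k\<bar> ^ m * norm (torus_heat_fourier b c s k)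
      \<le> C * min pi (1 / sqrt s) powr (real (1 + b) - real m)"
proof (induction m arbitrary: b c)
  case 0
  obtain C where C: "C \<ge> 0" "\<And>s L. s > 0 \<Longrightarrow> L > 0 \<Longrightarrow>
      (LINT x:cball (0::real) L|lborel. norm x ^ b * exp (- (4 / pi\<^sup>2) * s * (norm x)\<^sup>2))
      \<le> C * min L (1 / sqrt s) ^ (1 + b)"
    using ball_moment_bound[of "4 / pi\<^sup>2" b, where 'a=real] by auto
  show ?case
  proof (intro exI[of _ C] conjI allI impI)
    fix s :: real and k :: int assume s: "s > 0"
    let ?h = "\<lambda>x::real. norm x ^ b * exp (- (4 / pi\<^sup>2) * s * (norm x)\<^sup>2)"
    have "norm (torus_heat_fourier b c s k) \<le> (LINT x:{- pi..pi}|lborel. ?h x)"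
      unfolding torus_heat_fourier_def set_lebesgue_integral_def
    proof (rule Bochner_Integration.integral_norm_bound_integral)
      show "integrable lborel (\<lambda>\<theta>. indicat_real {- pi..pi} \<theta> *\<^sub>R (complex_of_real (sin \<theta> ^ b * cos \<theta> ^ c * exp (- s * (2 - 2 * cos \<theta>))) *
          exp (\<i> * complex_of_real (of_int k * \<theta>))))"
        using torus_heat_fourier_integrable unfolding set_integrable_def .
      show "integrable lborel (\<lambda>x. indicator {- pi..pi} x *\<^sub>R ?h x)"
        by (rule borel_integrable_compact) (auto intro!: continuous_intros)
      fix \<theta> :: real
      show "norm (indicat_real {- pi..pi} \<theta> *\<^sub>R (complex_of_real (sin \<theta> ^ b * cos \<theta> ^ c * exp (- s * (2 - 2 * cos \<theta>))) *
          exp (\<i> * complex_of_real (of_int k * \<theta>)))) \<le> indicator {- pi..pi} \<theta> *\<^sub>R ?h \<theta>"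
      proof (cases "\<theta> \<in> {- pi..pi}")
        case True
        then have "4 / pi\<^sup>2 * \<theta>\<^sup>2 \<le> 2 - 2 * cos \<theta>" by (intro two_minus_two_cos_lower_bound) auto
        then have "s * (4 / pi\<^sup>2 * \<theta>\<^sup>2) \<le> s * (2 - 2 * cos \<theta>)" using s by (intro mult_left_mono) auto
        then have e: "exp (- s * (2 - 2 * cos \<theta>)) \<le> exp (- (4 / pi\<^sup>2) * s * (norm \<theta>)\<^sup>2)" by (simp add: mult_ac)
        have "\<bar>sin \<theta>\<bar> ^ b * \<bar>cos \<theta>\<bar> ^ c * exp (- s * (2 - 2 * cos \<theta>)) \<le> norm \<theta> ^ b * 1 * exp (- (4 / pi\<^sup>2) * s * (norm \<theta>)\<^sup>2)"
          using abs_sin_x_le_abs_x[of \<theta>] by (intro mult_mono e power_mono power_le_one) auto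
        then show ?thesis using True by (simp add: norm_mult norm_power abs_mult)
      qed simp
    qed
    also have "{- pi..pi} = cball 0 pi" by (auto simp: cball_eq_atLeastAtMost)
    also have "(LINT x:cball 0 pi|lborel. ?h x) \<le> C * min pi (1 / sqrt s) ^ (1 + b)"
      using s by (intro C) auto
    also have "min pi (1 / sqrt s) ^ (1 + b) = min pi (1 / sqrt s) powr (real (1 + b) - real 0)"
      using s by (subst powr_realpow[symmetric]) auto
    finally show "\<bar>real_of_int k\<bar> ^ 0 * norm (torus_heat_fourier b c s k)
      \<le> C * min pi (1 / sqrt s) powr (real (1 + b) - real 0)" by simp
  qed (rule C)
next
  case (Suc m)
  let ?R = "\<lambda>s. min pi (1 / sqrt s)"
  obtain C1 where C1: "C1 \<ge> 0" "\<And>s k. s > 0 \<Longrightarrow> \<bar>real_of_int k\<bar> ^ m * norm (torus_heat_fourier (b - 1) (c + 1) s k)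
      \<le> C1 * ?R s powr (real (1 + (b - 1)) - real m)" using Suc.IH[of "b - 1" "c + 1"] by blast
  obtain C2 where C2: "C2 \<ge> 0" "\<And>s k. s > 0 \<Longrightarrow> \<bar>real_of_int k\<bar> ^ m * norm (torus_heat_fourier (b + 1) (c - 1) s k)
      \<le> C2 * ?R s powr (real (1 + (b + 1)) - real m)" using Suc.IH[of "b + 1" "c - 1"] by blast
  obtain C3 where C3: "C3 \<ge> 0" "\<And>s k. s > 0 \<Longrightarrow> \<bar>real_of_int k\<bar> ^ m * norm (torus_heat_fourier (b + 1) c s k)
      \<le> C3 * ?R s powr (real (1 + (b + 1)) - real m)" using Suc.IH[of "b + 1" c] by blast
  show ?case
  proof (intro exI[of _ "real b * C1 + real c * pi\<^sup>2 * C2 + 2 * C3"] conjI allI impI)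
    show "real b * C1 + real c * pi\<^sup>2 * C2 + 2 * C3 \<ge> 0" using C1 C2 C3 by simp
    fix s :: real and k :: int assume s: "s > 0"
    define R where "R = ?R s"
    define p where "p = real (1 + b) - real m"
    define K where "K = \<bar>real_of_int k\<bar> ^ m"
    have K: "K \<ge> 0" by (simp add: K_def)
    have R: "R > 0" "R \<le> pi" "R \<le> 1 / sqrt s" using s by (auto simp: R_def)
    have "R\<^sup>2 \<le> (1 / sqrt s)\<^sup>2" using R by (intro power_mono) auto
    then have sR: "s * R\<^sup>2 \<le> 1" using s by (simp add: power_divide field_simps)
    have S1: "s * R powr (p + 1) \<le> R powr (p - 1)"
      using mult_right_mono[OF sR, of "R powr (p - 1)"] R(1) by (simp add: powr_shift_two mult.assoc)
    \<comment> \<open>The term from differentiating the cosine comes without a factor \<open>s\<close>.\<close>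
    have P1: "R powr (p + 1) \<le> pi\<^sup>2 * R powr (p - 1)"
      unfolding powr_shift_two[OF R(1)] using R by (intro mult_right_mono power_mono) auto
    have pp: "real (1 + (b + 1)) - real m = p + 1" by (simp add: p_def)
    let ?A = "of_nat b * torus_heat_fourier (b - 1) (c + 1) s k"
    let ?B = "of_nat c * torus_heat_fourier (b + 1) (c - 1) s k"
    let ?C = "of_real (2 * s) * torus_heat_fourier (b + 1) c s k"
    have "\<i> * (of_int k * torus_heat_fourier b c s k) = ?C + ?B - ?A"
      using torus_heat_fourier_by_parts[of b c s k]
      by (simp add: algebra_simps eq_neg_iff_add_eq_0)
    then have "norm (of_int k * torus_heat_fourier b c s k) = norm (?C + ?B - ?A)"
      by (metis mult_1 norm_ii norm_mult)
    also have "\<dots> \<le> norm ?A + norm ?B + norm ?C"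
      using norm_triangle_ineq4[of "?C + ?B" ?A] norm_triangle_ineq[of ?C ?B] by simp
    finally have "K * norm (of_int k * torus_heat_fourier b c s k) \<le> K * norm ?A + K * norm ?B + K * norm ?C"
      using mult_left_mono[OF _ K] by (simp flip: distrib_left)
    also have "K * norm ?A \<le> real b * C1 * R powr (p - 1)"
    proof (cases "b = 0")
      case False
      then have "real (1 + (b - 1)) - real m = p - 1" by (simp add: p_def of_nat_diff)
      from C1(2)[OF s, of k, unfolded this]
      have "K * norm (torus_heat_fourier (b - 1) (c + 1) s k) \<le> C1 * R powr (p - 1)"
        unfolding R_def K_def .
      from mult_left_mono[OF this, of "real b"] show ?thesis by (simp add: norm_mult mult_ac)
    qed simp
    also have "K * norm ?B \<le> real c * pi\<^sup>2 * C2 * R powr (p - 1)"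
    proof -
      have "K * norm ?B = real c * (K * norm (torus_heat_fourier (b + 1) (c - 1) s k))" by (simp add: norm_mult)
      also have "\<dots> \<le> real c * (C2 * R powr (p + 1))"
        using C2(2)[OF s, of k] unfolding pp R_def[symmetric] K_def[symmetric] by (intro mult_left_mono) auto
      also have "\<dots> \<le> real c * (C2 * (pi\<^sup>2 * R powr (p - 1)))" using C2(1) by (intro mult_left_mono P1) auto
      finally show ?thesis by (simp add: mult_ac)
    qed
    also have "K * norm ?C \<le> 2 * C3 * R powr (p - 1)"
    proof -
      have "K * norm ?C = 2 * s * (K * norm (torus_heat_fourier (b + 1) c s k))" using s by (simp add: norm_mult)
      also have "\<dots> \<le> 2 * s * (C3 * R powr (p + 1))"
        using C3(2)[OF s, of k] s unfolding pp R_def[symmetric] K_def[symmetric] by (intro mult_left_mono) auto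
      also have "\<dots> = 2 * C3 * (s * R powr (p + 1))" by simp
      also have "\<dots> \<le> 2 * C3 * R powr (p - 1)" using C3(1) by (intro mult_left_mono S1) auto
      finally show ?thesis .
    qed
    finally show "\<bar>real_of_int k\<bar> ^ Suc m * norm (torus_heat_fourier b c s k)
      \<le> (real b * C1 + real c * pi\<^sup>2 * C2 + 2 * C3) * min pi (1 / sqrt s) powr (real (1 + b) - real (Suc m))"
      by (simp add: R_def p_def K_def norm_mult algebra_simps)
  qed
qed

section \<open>Negative powers as integrals of heat kernels\<close>

lemma subordination_weight_integrable:
  fixes t a :: real
  assumes "0 < t" "t < a"
  shows "set_integrable lborel {0<..} (\<lambda>s. s powr (t - 1) * min 1 (s powr - a))"
proof -
  have 1: "set_integrable lborel {0..1} (\<lambda>s. s powr (t - 1))"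
  proof -
    have "(\<lambda>s::real. s powr (t - 1)) absolutely_integrable_on {0..1}"
      using assms by (intro nonnegative_absolutely_integrable_1 integrable_on_powr_from_0) auto
    then show ?thesis
      unfolding set_integrable_def by (subst (asm) integrable_completion) auto
  qed
  have 2: "set_integrable lborel {1..} (\<lambda>s. s powr (t - 1 - a))"
  proof -
    have "((\<lambda>s. s powr (t - 1 - a)) has_integral -(1 powr (t - 1 - a + 1)) / (t - 1 - a + 1)) {1..}"
      using assms by (intro has_integral_powr_to_inf) auto
    then have "(\<lambda>s::real. s powr (t - 1 - a)) absolutely_integrable_on {1..}"
      by (intro nonnegative_absolutely_integrable_1) auto
    then show ?thesis
      unfolding set_integrable_def by (subst (asm) integrable_completion) auto
  qed
  have "integrable lborel (\<lambda>s. indicator {0..1} s *\<^sub>R s powr (t - 1) + indicator {1..} s *\<^sub>R s powr (t - 1 - a))"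
    using 1 2 unfolding set_integrable_def by (rule Bochner_Integration.integrable_add)
  then show ?thesis
    unfolding set_integrable_def
  proof (rule Bochner_Integration.integrable_bound)
    show "AE s in lborel. norm (indicat_real {0<..} s *\<^sub>R (s powr (t - 1) * min 1 (s powr - a)))
      \<le> norm (indicator {0..1} s *\<^sub>R s powr (t - 1) + indicator {1..} s *\<^sub>R s powr (t - 1 - a))"
    proof (rule AE_I2)
      fix s :: real
      consider "s \<le> 0" | "0 < s" "s \<le> 1" | "s > 1" by linarith
      then show "norm (indicat_real {0<..} s *\<^sub>R (s powr (t - 1) * min 1 (s powr - a)))
        \<le> norm (indicator {0..1} s *\<^sub>R s powr (t - 1) + indicator {1..} s *\<^sub>R s powr (t - 1 - a))"
      proof cases
        case 2
        have "s powr (t - 1) * min 1 (s powr - a) \<le> s powr (t - 1) * 1" by (intro mult_left_mono) auto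
        moreover have "0 \<le> s powr (t - 1) * min 1 (s powr - a)" by simp
        ultimately show ?thesis using 2 by (auto simp: indicator_def)
      next
        case 3
        have "s powr (t - 1) * min 1 (s powr - a) \<le> s powr (t - 1) * s powr - a" by (intro mult_left_mono) auto
        also have "\<dots> = s powr (t - 1 - a)" by (simp flip: powr_add)
        finally show ?thesis using 3 by (auto simp: indicator_def)
      qed auto
    qed
  qed auto
qed

lemma Gamma_integral_scaled:
  fixes t l :: real
  assumes "t > 0" "l > 0"
  shows "(LINT s:{0<..}|lborel. s powr (t - 1) * exp (- s * l)) = Gamma t * l powr - t"
proof -
  define g where "g s = indicat_real {0<..} s * (s powr (t - 1) * exp (- s))" for s
  have "has_bochner_integral lborel g (Gamma t)"
  proof (rule has_bochner_integral_nn_integral)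
    have "(\<integral>\<^sup>+ s. ennreal (g s) \<partial>lborel) = (\<integral>\<^sup>+ s. ennreal (indicator {0..} s * s powr (t - 1) / exp s) \<partial>lborel)"
      by (intro nn_integral_cong arg_cong[of _ _ ennreal]) (auto simp: g_def indicator_def exp_minus field_simps)
    then show "(\<integral>\<^sup>+ s. ennreal (g s) \<partial>lborel) = ennreal (Gamma t)"
      using Gamma_conv_nn_integral_real[OF assms(1)] by simp
    show "g \<in> borel_measurable lborel" unfolding g_def by measurable
  qed (use assms in \<open>auto simp: g_def less_imp_le[OF Gamma_real_pos]\<close>)
  then have "Gamma t = integral\<^sup>L lborel g" by (simp add: has_bochner_integral_iff)
  also have "\<dots> = \<bar>l\<bar> *\<^sub>R (LINT s|lborel. g (0 + l * s))"
    using assms by (intro lborel_integral_real_affine) auto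
  also have "(\<lambda>s. g (0 + l * s)) = (\<lambda>s. l powr (t - 1) * (indicat_real {0<..} s *\<^sub>R (s powr (t - 1) * exp (- s * l))))"
    using assms by (auto simp: g_def fun_eq_iff powr_mult indicator_def zero_less_mult_iff mult.commute)
  finally have "Gamma t = l * l powr (t - 1) * (LINT s:{0<..}|lborel. s powr (t - 1) * exp (- s * l))"
    using assms by (simp add: set_lebesgue_integral_def)
  also have "l * l powr (t - 1) = l powr t" using assms by (simp add: powr_diff)
  finally show ?thesis using assms by (simp add: powr_minus field_simps)
qed

text \<open>The order of integration is exchanged by Fubini; absolute integrability on the product is read off
with the integral over \<open>x\<close> taken first, so that no local integrability of \<open>\<psi> powr - t\<close> has to be
checked beforehand.\<close>

lemma subordination:
  fixes f :: "'a::euclidean_space \<Rightarrow> complex" and \<psi> :: "'a \<Rightarrow> real"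
  assumes [measurable]: "f \<in> borel_measurable borel" "\<psi> \<in> borel_measurable borel"
    and ta: "0 < t" "t < a"
    and int: "\<And>s. s > 0 \<Longrightarrow> integrable lborel (\<lambda>x. f x * complex_of_real (exp (- s * \<psi> x)))"
    and bd: "\<And>s. s > 0 \<Longrightarrow> (LINT x|lborel. norm (f x) * exp (- s * \<psi> x)) \<le> C * min 1 (s powr - a)"
    and pos: "AE x in lborel. f x \<noteq> 0 \<longrightarrow> \<psi> x > 0"
  shows "(LINT x|lborel. complex_of_real (\<psi> x powr - t) * f x) =
    complex_of_real (1 / Gamma t) * (LINT s:{0<..}|lborel. complex_of_real (s powr (t - 1)) *
      (LINT x|lborel. f x * complex_of_real (exp (- s * \<psi> x))))"
proof -
  define F where "F s x = complex_of_real (indicat_real {0<..} s * s powr (t - 1)) * (f x * complex_of_real (exp (- s * \<psi> x)))" for s x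
  have i: "integrable (lborel \<Otimes>\<^sub>M lborel) (case_prod F)"
  proof (rule lborel_pair.Fubini_integrable)
    show "case_prod F \<in> borel_measurable (lborel \<Otimes>\<^sub>M lborel)"
      unfolding F_def by measurable
    show "AE s in lborel. integrable lborel (\<lambda>x. case (s, x) of (s, x) \<Rightarrow> F s x)"
    proof (rule AE_I2)
      fix s :: real
      show "integrable lborel (\<lambda>x. case (s, x) of (s, x) \<Rightarrow> F s x)"
        using int[of s] by (cases "s > 0") (auto simp: F_def)
    qed
    have nF: "(LINT x|lborel. norm (F s x)) = (indicat_real {0<..} s * s powr (t - 1)) * (LINT x|lborel. norm (f x) * exp (- s * \<psi> x))" for s
      by (simp add: F_def norm_mult)
    show "integrable lborel (\<lambda>s. LINT x|lborel. norm (case (s, x) of (s, x) \<Rightarrow> F s x))"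
    proof (rule Bochner_Integration.integrable_bound)
      show "integrable lborel (\<lambda>s. C * (indicat_real {0<..} s *\<^sub>R (s powr (t - 1) * min 1 (s powr - a))))"
        using subordination_weight_integrable[OF ta] unfolding set_integrable_def by (rule integrable_mult_right)
      show "(\<lambda>s. LINT x|lborel. norm (case (s, x) of (s, x) \<Rightarrow> F s x)) \<in> borel_measurable lborel"
        unfolding F_def by measurable
      show "AE s in lborel. norm (LINT x|lborel. norm (case (s, x) of (s, x) \<Rightarrow> F s x))
         \<le> norm (C * (indicat_real {0<..} s *\<^sub>R (s powr (t - 1) * min 1 (s powr - a))))"
      proof (rule AE_I2)
        fix s :: real
        show "norm (LINT x|lborel. norm (case (s, x) of (s, x) \<Rightarrow> F s x))
         \<le> norm (C * (indicat_real {0<..} s *\<^sub>R (s powr (t - 1) * min 1 (s powr - a))))"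
        proof (cases "s > 0")
          case True
          have n: "0 \<le> (LINT x|lborel. norm (f x) * exp (- s * \<psi> x))" by (rule Bochner_Integration.integral_nonneg) auto
          then have "s powr (t - 1) * (LINT x|lborel. norm (f x) * exp (- s * \<psi> x)) \<le> s powr (t - 1) * (C * min 1 (s powr - a))"
            using bd[OF True] by (intro mult_left_mono) auto
          also have "\<dots> \<le> norm (C * (s powr (t - 1) * min 1 (s powr - a)))"
            by (simp add: mult_ac)
          finally show ?thesis using True n by (simp add: nF)
        qed (simp add: nF)
      qed
    qed
  qed
  have "(LINT x|lborel. (LINT s|lborel. F s x)) = (LINT s|lborel. (LINT x|lborel. F s x))"
    by (rule lborel_pair.Fubini_integral[OF i])
  also have "\<dots> = (LINT s:{0<..}|lborel. complex_of_real (s powr (t - 1)) *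
      (LINT x|lborel. f x * complex_of_real (exp (- s * \<psi> x))))"
    unfolding set_lebesgue_integral_def F_def
    by (intro Bochner_Integration.integral_cong) (auto simp: indicator_def)
  also have "(LINT x|lborel. (LINT s|lborel. F s x)) = (LINT x|lborel. complex_of_real (Gamma t) * (complex_of_real (\<psi> x powr - t) * f x))"
  proof (rule integral_cong_AE)
    show "AE x in lborel. (LINT s|lborel. F s x) = complex_of_real (Gamma t) * (complex_of_real (\<psi> x powr - t) * f x)"
      using pos
    proof eventually_elim
      case (elim x)
      show ?case
      proof (cases "f x = 0")
        case False
        then have p: "\<psi> x > 0" using elim by simp
        have "(LINT s|lborel. F s x) = f x * (LINT s|lborel. complex_of_real (indicat_real {0<..} s *\<^sub>R (s powr (t - 1) * exp (- s * \<psi> x))))"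
          by (subst integral_mult_right_zero[symmetric]) (simp add: F_def mult_ac)
        also have "(LINT s|lborel. complex_of_real (indicat_real {0<..} s *\<^sub>R (s powr (t - 1) * exp (- s * \<psi> x)))) = complex_of_real (Gamma t * \<psi> x powr - t)"
          using Gamma_integral_scaled[OF ta(1) p] unfolding integral_complex_of_real set_lebesgue_integral_def by simp
        finally show ?thesis by (simp add: mult_ac)
      qed (simp add: F_def)
    qed
  qed (auto simp: F_def)
  also have "\<dots> = complex_of_real (Gamma t) * (LINT x|lborel. complex_of_real (\<psi> x powr - t) * f x)"
    by (rule integral_mult_right_zero)
  finally show ?thesis
    using Gamma_real_pos[OF ta(1)] by (simp add: field_simps)
qed

lemma inverse_sqrt_power: "s > 0 \<Longrightarrow> (1 / sqrt s) ^ d = s powr - (real d / 2)"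
proof -
  assume s: "s > 0"
  then have "(1 / sqrt s) = s powr (- 1/2)" by (simp add: powr_minus powr_half_sqrt field_simps)
  then show ?thesis using s by (simp add: powr_realpow[symmetric] powr_powr)
qed

lemma min_power_le_subordination_weight:
  fixes s L :: real
  assumes "s > 0" "L > 0"
  shows "min L (1 / sqrt s) ^ d \<le> max 1 L ^ d * min 1 (s powr - (real d / 2))"
proof -
  have "min L (1 / sqrt s) ^ d \<le> max 1 L ^ d" using assms by (intro power_mono) auto
  moreover have "min L (1 / sqrt s) ^ d \<le> max 1 L ^ d * (1 / sqrt s) ^ d"
  proof -
    have "min L (1 / sqrt s) ^ d \<le> 1 * (1 / sqrt s) ^ d" using assms by (auto intro: power_mono)
    also have "\<dots> \<le> max 1 L ^ d * (1 / sqrt s) ^ d" using assms by (intro mult_right_mono one_le_power) auto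
    finally show ?thesis .
  qed
  ultimately show ?thesis unfolding inverse_sqrt_power[OF assms(1)] by (simp add: min_def)
qed

lemma subordinated_limit:
  fixes G :: "nat \<Rightarrow> real \<Rightarrow> complex"
  assumes ta: "0 < t" "t < a"
    and [measurable]: "\<And>n. G n \<in> borel_measurable borel" "g \<in> borel_measurable borel"
    and bd: "\<And>n s. s > 0 \<Longrightarrow> norm (G n s) \<le> C * min 1 (s powr - a)"
    and lim: "\<And>s. s > 0 \<Longrightarrow> (\<lambda>n. G n s) \<longlonglongrightarrow> g s"
  shows "(\<lambda>n. LINT s:{0<..}|lborel. complex_of_real (s powr (t - 1)) * G n s)
    \<longlonglongrightarrow> (LINT s:{0<..}|lborel. complex_of_real (s powr (t - 1)) * g s)"
  unfolding set_lebesgue_integral_def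
proof (rule integral_dominated_convergence)
  show "integrable lborel (\<lambda>s. C * (indicat_real {0<..} s *\<^sub>R (s powr (t - 1) * min 1 (s powr - a))))"
    using subordination_weight_integrable[OF ta] unfolding set_integrable_def by (rule integrable_mult_right)
  show "AE s in lborel. (\<lambda>n. indicat_real {0<..} s *\<^sub>R (complex_of_real (s powr (t - 1)) * G n s))
     \<longlonglongrightarrow> indicat_real {0<..} s *\<^sub>R (complex_of_real (s powr (t - 1)) * g s)"
    using lim by (intro AE_I2) (auto simp: indicator_def intro!: tendsto_intros)
  show "AE s in lborel. norm (indicat_real {0<..} s *\<^sub>R (complex_of_real (s powr (t - 1)) * G n s))
    \<le> C * (indicat_real {0<..} s *\<^sub>R (s powr (t - 1) * min 1 (s powr - a)))" for n
  proof (rule AE_I2)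
    fix s :: real
    show "norm (indicat_real {0<..} s *\<^sub>R (complex_of_real (s powr (t - 1)) * G n s))
      \<le> C * (indicat_real {0<..} s *\<^sub>R (s powr (t - 1) * min 1 (s powr - a)))"
    proof (cases "s > 0")
      case True
      from mult_left_mono[OF bd[OF True, of n], of "s powr (t - 1)"] True
      show ?thesis by (simp add: norm_mult mult_ac)
    qed simp
  qed
qed (measurable)

text \<open>The form of \<open>subordination\<close> for both applications. A quadratic lower bound on \<open>\<psi>\<close> over a bounded
support gives the hypothesis on the heat integrals through \<open>ball_moment_bound\<close>, and it leaves the
origin as the only possible zero of \<open>\<psi>\<close> on the support of \<open>f\<close>.\<close>

lemma subordination_on_ball:
  fixes f :: "'a::euclidean_space \<Rightarrow> complex" and \<psi> :: "'a \<Rightarrow> real"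
  assumes [measurable]: "f \<in> borel_measurable borel" "\<psi> \<in> borel_measurable borel"
    and t: "0 < t" "t < real DIM('a) / 2"
    and K: "\<And>x. norm (f x) \<le> K" and supp: "\<And>x. norm x > L \<Longrightarrow> f x = 0" and L: "L > 0"
    and c: "c > 0" "\<And>x. f x \<noteq> 0 \<Longrightarrow> c * (norm x)\<^sup>2 \<le> \<psi> x"
  shows "(LINT x|lborel. complex_of_real (\<psi> x powr - t) * f x) =
    complex_of_real (1 / Gamma t) * (LINT s:{0<..}|lborel. complex_of_real (s powr (t - 1)) *
      (LINT x|lborel. f x * complex_of_real (exp (- s * \<psi> x))))"
proof -
  obtain C where C: "C \<ge> 0" "\<And>s L. s > 0 \<Longrightarrow> L > 0 \<Longrightarrow>
      (LINT x:cball (0::'a::euclidean_space) L|lborel. norm x ^ 0 * exp (- c * s * (norm x)\<^sup>2))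
      \<le> C * min L (1 / sqrt s) ^ (DIM('a) + 0)"
    using ball_moment_bound[OF c(1), of 0, where 'a='a] by auto
  have K0: "K \<ge> 0" using norm_ge_zero K by (rule order_trans)
  have pt: "norm (f x) * exp (- s * \<psi> x) \<le> indicat_real (cball 0 L) x *\<^sub>R (K * (norm x ^ 0 * exp (- c * s * (norm x)\<^sup>2)))"
    if s: "s > 0" for s x
  proof (cases "f x = 0")
    case False
    then have "norm x \<le> L" using supp[of x] by force
    moreover have "norm (f x) * exp (- s * \<psi> x) \<le> K * exp (- c * s * (norm x)\<^sup>2)"
      using mult_left_mono[OF c(2)[OF False], of s] s K0 K[of x] by (intro mult_mono) (auto simp: mult_ac)
    ultimately show ?thesis by simp
  qed (use K0 in auto)
  have i: "integrable lborel (\<lambda>x::'a. indicat_real (cball 0 L) x *\<^sub>R (K * (norm x ^ 0 * exp (- c * s * (norm x)\<^sup>2))))" for s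
    by (rule borel_integrable_compact) (auto intro!: continuous_intros)
  show ?thesis
  proof (rule subordination[OF _ _ t])
    fix s :: real assume s: "s > 0"
    show int: "integrable lborel (\<lambda>x. f x * complex_of_real (exp (- s * \<psi> x)))"
      using pt[OF s] by (intro Bochner_Integration.integrable_bound[OF i[of s]] AE_I2) (auto simp: norm_mult intro: order_trans[OF _ abs_ge_self])
    have "(LINT x|lborel. norm (f x) * exp (- s * \<psi> x)) \<le> (LINT x:cball (0::'a) L|lborel. K * (norm x ^ 0 * exp (- c * s * (norm x)\<^sup>2)))"
      unfolding set_lebesgue_integral_def using integrable_norm[OF int]
      by (intro integral_mono i pt s) (simp add: norm_mult)
    also have "\<dots> \<le> K * (C * min L (1 / sqrt s) ^ (DIM('a) + 0))"
      unfolding set_integral_mult_right using K0 C(2)[OF s L] by (intro mult_left_mono) auto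
    also have "\<dots> \<le> K * (C * (max 1 L ^ DIM('a) * min 1 (s powr - (real DIM('a) / 2))))"
      using K0 C(1) min_power_le_subordination_weight[OF s L, of "DIM('a)"] by (intro mult_left_mono) auto
    finally show "(LINT x|lborel. norm (f x) * exp (- s * \<psi> x)) \<le> (K * C * max 1 L ^ DIM('a)) * min 1 (s powr - (real DIM('a) / 2))"
      by (simp add: mult_ac)
  next
    show "AE x in lborel. f x \<noteq> 0 \<longrightarrow> 0 < \<psi> x"
      using AE_lborel_singleton[of 0]
    proof eventually_elim
      case (elim x)
      then have "0 < c * (norm x)\<^sup>2" using c(1) by simp
      then show ?case using c(2)[of x] by force
    qed
  qed auto
qed

lemma radial_cutoffD:
  assumes "radial_cutoff \<kappa>"
  shows "Ck m \<kappa>" "norm x > 1 \<Longrightarrow> \<kappa> x = 0" "norm x \<le> 1 / 2 \<Longrightarrow> \<kappa> x = 1"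
proof -
  have "smooth \<kappa>" "\<forall>x. norm x \<le> 1 / 2 \<longrightarrow> \<kappa> x = 1" "\<forall>x. norm x \<ge> 1 \<longrightarrow> \<kappa> x = 0"
    using assms unfolding radial_cutoff_def by blast+
  then show "Ck m \<kappa>" "norm x > 1 \<Longrightarrow> \<kappa> x = 0" "norm x \<le> 1 / 2 \<Longrightarrow> \<kappa> x = 1"
    by (auto simp: smooth_def)
qed

section \<open>Removing the cutoff\<close>

text \<open>A filter pulled back from \<open>at_top\<close> along a real function is countably generated, so limits can be tested
on sequences, where dominated convergence applies.\<close>

lemma tendsto_filtercomap_at_top_sequentially:
  fixes f :: "'a \<Rightarrow> 'b::metric_space" and g :: "'a \<Rightarrow> real"
  assumes "\<And>X::nat \<Rightarrow> 'a. filterlim (\<lambda>n. g (X n)) at_top sequentially \<Longrightarrow> (\<And>n. g (X n) \<ge> 1) \<Longrightarrow>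
    (\<lambda>n. f (X n)) \<longlonglongrightarrow> L"
  shows "(f \<longlongrightarrow> L) (filtercomap g at_top)"
proof (rule ccontr)
  assume "\<not> (f \<longlongrightarrow> L) (filtercomap g at_top)"
  then obtain e where e: "e > 0" "\<not> eventually (\<lambda>x. dist (f x) L < e) (filtercomap g at_top)"
    unfolding tendsto_iff by auto
  then have "\<exists>x. g x \<ge> N \<and> dist (f x) L \<ge> e" for N
    unfolding eventually_filtercomap_at_top_linorder by (auto simp: not_less)
  then have "\<forall>n::nat. \<exists>x. g x \<ge> real n + 1 \<and> dist (f x) L \<ge> e" by blast
  then obtain X where X: "\<And>n::nat. g (X n) \<ge> real n + 1" "\<And>n. dist (f (X n)) L \<ge> e"
    by metis
  have "(\<lambda>n. f (X n)) \<longlonglongrightarrow> L"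
  proof (rule assms)
    have "filterlim (\<lambda>n. real n + 1) at_top sequentially" by real_asymp
    then show "filterlim (\<lambda>n. g (X n)) at_top sequentially"
      by (rule filterlim_at_top_mono) (use X in auto)
    show "g (X n) \<ge> 1" for n using X(1)[of n] by simp
  qed
  then have "eventually (\<lambda>n. dist (f (X n)) L < e) sequentially"
    using e(1) unfolding tendsto_iff by blast
  then show False using X(2) by (auto simp: eventually_sequentially not_less[symmetric])
qed

text \<open>The value of \<open>A_const\<close>, as the subordination integral of the Gaussian heat kernel at unit distance,
up to the factor \<open>(2 * pi) ^ d\<close>. In closed form it is \<open>pi powr (d / 2) * 2 ^ d * 2 powr (- 2 * t) * Gamma (d / 2 - t) / Gamma t\<close>, the constant of the Riesz kernel.\<close>

definition riesz_constant :: "real \<Rightarrow> nat \<Rightarrow> complex" where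
  "riesz_constant t d = complex_of_real (1 / Gamma t) * (LINT u:{0<..}|lborel.
     complex_of_real (u powr (t - 1)) * complex_of_real (sqrt (pi / u) ^ d * exp (- 1 / (4 * u))))"

lemma A_trunc_subordination:
  fixes \<kappa> :: "real ^ 'd \<Rightarrow> complex"
  assumes t: "0 < t" "t < real CARD('d) / 2" and k: "radial_cutoff \<kappa>" and N: "N > 0"
  shows "A_trunc t \<kappa> \<omega> N = complex_of_real (1 / Gamma t) * (LINT s:{0<..}|lborel.
    complex_of_real (s powr (t - 1)) * cutoff_gaussian_fourier \<omega> \<kappa> 0 s N)"
proof -
  have kc: "continuous_on UNIV \<kappa>"
    using radial_cutoffD(1)[OF k] by (rule Ck_continuous)
  note ksupp = radial_cutoffD(2)[OF k]
  obtain K where K: "K \<ge> 0" "\<And>x. norm (\<kappa> x) \<le> K"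
    using continuous_bounded_support_bounded[OF kc ksupp] by metis
  define f where "f x = \<kappa> (x /\<^sub>R N) * exp (\<i> * complex_of_real (\<omega> \<bullet> x))" for x
  have fc: "continuous_on UNIV f" unfolding f_def
    by (intro continuous_intros continuous_on_compose2[OF kc]) auto
  have p: "(norm x)\<^sup>2 powr - t = norm x powr (- 2 * t)" for x :: "real ^ 'd"
  proof -
    have "(norm x)\<^sup>2 powr - t = (norm x powr 2) powr - t" by simp
    then show ?thesis by (simp only: powr_powr) simp
  qed
  have "(LINT x|lborel. complex_of_real ((norm x)\<^sup>2 powr - t) * f x) =
    complex_of_real (1 / Gamma t) * (LINT s:{0<..}|lborel. complex_of_real (s powr (t - 1)) *
      (LINT x|lborel. f x * complex_of_real (exp (- s * (norm x)\<^sup>2))))"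
  proof (rule subordination_on_ball[where K=K and L=N and c=1])
    show "f \<in> borel_measurable borel" by (rule borel_measurable_continuous_onI[OF fc])
    show "norm (f x) \<le> K" for x using K by (simp add: f_def norm_mult)
    show "f x = 0" if "norm x > N" for x
      using that N unfolding f_def by (subst ksupp) (auto simp: field_simps)
  qed (use t N in auto)
  moreover have "A_trunc t \<kappa> \<omega> N = (LINT x|lborel. complex_of_real ((norm x)\<^sup>2 powr - t) * f x)"
    unfolding A_trunc_def f_def p by (simp only: mult.assoc)
  moreover have "cutoff_gaussian_fourier \<omega> \<kappa> 0 s N = (LINT x|lborel. f x * complex_of_real (exp (- s * (norm x)\<^sup>2)))" for s
    unfolding cutoff_gaussian_fourier_def f_def by (simp only: power_0 mult_1 mult_ac)
  ultimately show ?thesis by (simp only:)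
qed

text \<open>The domination uses \<open>cutoff_gaussian_fourier_decay\<close> twice: without derivatives for large \<open>s\<close>, and with
\<open>d\<close> derivatives for small \<open>s\<close>. For fixed \<open>s\<close> the cutoff is removed under the integral and leaves the
Fourier transform of a Gaussian at a unit vector.\<close>

lemma A_trunc_tendsto:
  fixes \<kappa> :: "real ^ 'd \<Rightarrow> complex"
  assumes t: "0 < t" "t < real CARD('d) / 2" and k: "radial_cutoff \<kappa>" and w: "norm \<omega> = 1"
  shows "(A_trunc t \<kappa> \<omega> \<longlongrightarrow> riesz_constant t CARD('d)) at_top"
proof -
  let ?d = "CARD('d)"
  note Ck = radial_cutoffD(1)[OF k] and ksupp = radial_cutoffD(2)[OF k] and k1 = radial_cutoffD(3)[OF k]
  have kc: "continuous_on UNIV \<kappa>" using Ck[of 0] by (rule Ck_continuous)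
  have [measurable]: "\<kappa> \<in> borel_measurable borel" by (rule borel_measurable_continuous_onI[OF kc])
  obtain K where K: "K \<ge> 0" "\<And>x. norm (\<kappa> x) \<le> K"
    using continuous_bounded_support_bounded[OF kc ksupp] by metis
  obtain C0 where C0: "C0 \<ge> 0" "\<And>s N. s > 0 \<Longrightarrow> N > 0 \<Longrightarrow> norm (cutoff_gaussian_fourier \<omega> \<kappa> 0 s N)
      \<le> C0 * min N (1 / sqrt s) powr (real (?d + 0) - real 0)"
    using cutoff_gaussian_fourier_decay[OF w Ck[of 0] ksupp, of 0] by auto
  obtain C1 where C1: "C1 \<ge> 0" "\<And>s N. s > 0 \<Longrightarrow> N > 0 \<Longrightarrow> norm (cutoff_gaussian_fourier \<omega> \<kappa> 0 s N)
      \<le> C1 * min N (1 / sqrt s) powr (real (?d + 0) - real ?d)"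
    using cutoff_gaussian_fourier_decay[OF w Ck[of ?d] ksupp, of 0] by auto
  have bd: "norm (cutoff_gaussian_fourier \<omega> \<kappa> 0 s N) \<le> max C0 C1 * min 1 (s powr - (real ?d / 2))"
    if s: "s > 0" and N: "N > 0" for s N
  proof -
    have "norm (cutoff_gaussian_fourier \<omega> \<kappa> 0 s N) \<le> C0 * min N (1 / sqrt s) ^ ?d"
      using C0(2)[OF s N] s N by (simp add: powr_realpow)
    also have "\<dots> \<le> C0 * (1 / sqrt s) ^ ?d"
      using s N C0(1) by (intro mult_left_mono power_mono) auto
    also have "\<dots> \<le> max C0 C1 * s powr - (real ?d / 2)"
      unfolding inverse_sqrt_power[OF s] by (intro mult_right_mono) auto
    finally have 1: "norm (cutoff_gaussian_fourier \<omega> \<kappa> 0 s N) \<le> max C0 C1 * s powr - (real ?d / 2)" .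
    have "min N (1 / sqrt s) > 0" using s N by simp
    then have "norm (cutoff_gaussian_fourier \<omega> \<kappa> 0 s N) \<le> C1" using C1(1) C1(2)[OF s N] by (auto split: if_splits)
    then have "norm (cutoff_gaussian_fourier \<omega> \<kappa> 0 s N) \<le> max C0 C1 * 1" by simp
    with 1 show ?thesis by (simp add: min_def)
  qed
  have seq: "(\<lambda>n. A_trunc t \<kappa> \<omega> (X n)) \<longlonglongrightarrow> riesz_constant t ?d"
    if X: "filterlim X at_top sequentially" "\<And>n. X n \<ge> 1" for X :: "nat \<Rightarrow> real"
  proof -
    have X0: "X n > 0" for n using X(2)[of n] by simp
    show ?thesis
      unfolding A_trunc_subordination[OF t k X0] riesz_constant_def
    proof (intro tendsto_mult_left subordinated_limit[OF t])
      show "(\<lambda>s. cutoff_gaussian_fourier \<omega> \<kappa> 0 s (X n)) \<in> borel_measurable borel" for n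
        unfolding cutoff_gaussian_fourier_def by measurable
      show "norm (cutoff_gaussian_fourier \<omega> \<kappa> 0 s (X n)) \<le> max C0 C1 * min 1 (s powr - (real ?d / 2))"
        if "s > 0" for s n using bd[OF that X0] .
      fix s :: real assume s: "s > 0"
      \<comment> \<open>For fixed \<open>x\<close> the cutoff equals \<open>1\<close> as soon as \<open>X n \<ge> 2 * norm x\<close>.\<close>
      have "(\<lambda>n. cutoff_gaussian_fourier \<omega> \<kappa> 0 s (X n)) \<longlonglongrightarrow>
         (LINT x|lborel. complex_of_real (exp (- s * (norm x)\<^sup>2)) * exp (\<i> * complex_of_real (\<omega> \<bullet> x)))"
        unfolding cutoff_gaussian_fourier_def
      proof (rule integral_dominated_convergence)
        show "integrable lborel (\<lambda>x::real^'d. K * exp (- s * (norm x)\<^sup>2))"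
          by (intro integrable_mult_right gaussian_integral(1) s)
        show "AE x in lborel. (\<lambda>n. \<kappa> (x /\<^sub>R X n) * complex_of_real ((\<omega> \<bullet> x) ^ 0 * exp (- s * (norm x)\<^sup>2)) * exp (\<i> * complex_of_real (\<omega> \<bullet> x)))
          \<longlonglongrightarrow> complex_of_real (exp (- s * (norm x)\<^sup>2)) * exp (\<i> * complex_of_real (\<omega> \<bullet> x))"
        proof (rule AE_I2)
          fix x :: "real ^ 'd"
          have "eventually (\<lambda>n. X n \<ge> 2 * norm x) sequentially"
            using X(1) unfolding filterlim_at_top by blast
          then have "eventually (\<lambda>n. \<kappa> (x /\<^sub>R X n) * complex_of_real ((\<omega> \<bullet> x) ^ 0 * exp (- s * (norm x)\<^sup>2)) * exp (\<i> * complex_of_real (\<omega> \<bullet> x))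
            = complex_of_real (exp (- s * (norm x)\<^sup>2)) * exp (\<i> * complex_of_real (\<omega> \<bullet> x))) sequentially"
          proof eventually_elim
            case (elim n)
            have "\<kappa> (x /\<^sub>R X n) = 1" using elim X0[of n] by (intro k1) (simp add: field_simps)
            then show ?case by simp
          qed
          then show "(\<lambda>n. \<kappa> (x /\<^sub>R X n) * complex_of_real ((\<omega> \<bullet> x) ^ 0 * exp (- s * (norm x)\<^sup>2)) * exp (\<i> * complex_of_real (\<omega> \<bullet> x)))
            \<longlonglongrightarrow> complex_of_real (exp (- s * (norm x)\<^sup>2)) * exp (\<i> * complex_of_real (\<omega> \<bullet> x))"
            by (rule tendsto_eventually)
        qed
        show "AE x in lborel. norm (\<kappa> (x /\<^sub>R X n) * complex_of_real ((\<omega> \<bullet> x) ^ 0 * exp (- s * (norm x)\<^sup>2)) * exp (\<i> * complex_of_real (\<omega> \<bullet> x)))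
          \<le> K * exp (- s * (norm x)\<^sup>2)" for n
          using K(2) by (intro AE_I2) (simp add: norm_mult)
      qed measurable
      then show "(\<lambda>n. cutoff_gaussian_fourier \<omega> \<kappa> 0 s (X n)) \<longlonglongrightarrow> complex_of_real (sqrt (pi / s) ^ ?d * exp (- 1 / (4 * s)))"
        unfolding gaussian_fourier(2)[OF s] w by simp
    qed measurable
  qed
  have "(A_trunc t \<kappa> \<omega> \<longlongrightarrow> riesz_constant t CARD('d)) (filtercomap (\<lambda>x. x) at_top)"
    by (rule tendsto_filtercomap_at_top_sequentially) (rule seq)
  then show ?thesis by (simp add: filtercomap_ident)
qed

section \<open>The lattice heat kernel\<close>

lemma lborel_integral_scaleR:
  fixes g :: "'a::euclidean_space \<Rightarrow> complex"
  assumes [measurable]: "g \<in> borel_measurable borel" and c: "c > 0"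
  shows "(LINT x|lborel. g x) = of_real (c ^ DIM('a)) * (LINT x|lborel. g (c *\<^sub>R x))"
proof -
  have c0: "c \<noteq> 0" using c by simp
  have "(LINT x|lborel. g x) = integral\<^sup>L (density (distr lborel borel (\<lambda>x. 0 + c *\<^sub>R x)) (\<lambda>_. ennreal (\<bar>c\<bar> ^ DIM('a)))) g"
    using lborel_affine[OF c0, of "0::'a"] by simp
  also have "\<dots> = integral\<^sup>L (distr lborel borel (\<lambda>x. 0 + c *\<^sub>R x)) (\<lambda>x. \<bar>c\<bar> ^ DIM('a) *\<^sub>R g x)"
    by (rule integral_density) auto
  also have "\<dots> = (LINT x|lborel. \<bar>c\<bar> ^ DIM('a) *\<^sub>R g (0 + c *\<^sub>R x))"
    by (rule integral_distr) auto
  finally show ?thesis using c by (simp add: scaleR_conv_of_real)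
qed

lemma integral_prod_cart:
  fixes f :: "'d::finite \<Rightarrow> real \<Rightarrow> complex"
  assumes "\<And>i. integrable lborel (f i)"
  shows "(LINT x|lborel. (\<Prod>i\<in>UNIV. f i (x $ i))) = (\<Prod>i\<in>UNIV. LINT y|lborel. f i y)"
proof -
  have B: "(Basis :: (real ^ 'd) set) = range (\<lambda>i. axis i 1)"
    by (auto simp: Basis_vec_def)
  have inj: "inj (\<lambda>i::'d. axis i (1::real))" by (auto simp: inj_def axis_eq_axis)
  have r: "(\<Prod>b\<in>Basis. h b) = (\<Prod>i\<in>UNIV. h (axis i 1))" for h :: "real ^ 'd \<Rightarrow> complex"
    unfolding B by (subst prod.reindex[OF inj]) simp
  have inv: "inv (\<lambda>i::'d. axis i (1::real)) (axis i 1) = i" for i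
    by (rule inv_f_f[OF inj])
  show ?thesis
    using integral_prod_Basis(1)[of "\<lambda>b :: real ^ 'd. f (inv (\<lambda>i. axis i (1 :: real)) b)"] assms
    unfolding r inv by (simp add: cart_eq_inner_axis)
qed

text \<open>Up to the factor \<open>(2 * pi) ^ d\<close>, the heat kernel of the lattice at time \<open>s\<close> and displacement \<open>z\<close>.\<close>

definition lattice_heat :: "real \<Rightarrow> real ^ 'd \<Rightarrow> complex" where
  "lattice_heat s z = (LINT \<xi>|lborel. (indicator (cbox (\<chi> j. - pi) (\<chi> j. pi)) \<xi> *\<^sub>R exp (\<i> * complex_of_real (z \<bullet> \<xi>))) *
     complex_of_real (exp (- s * Phi \<xi>)))"

lemma mem_torus_box: "\<xi> \<in> cbox (\<chi> j. - pi) (\<chi> j. pi) \<longleftrightarrow> (\<forall>j. \<bar>\<xi> $ j\<bar> \<le> pi)" for \<xi> :: "real ^ 'd"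
  by (auto simp: mem_box_cart abs_le_iff minus_le_iff)

lemma Phi_measurable [measurable]: "(Phi :: real ^ 'd \<Rightarrow> real) \<in> borel_measurable borel"
proof (rule borel_measurable_continuous_onI)
  show "continuous_on UNIV (Phi :: real ^ 'd \<Rightarrow> real)"
    unfolding Phi_def[abs_def] by (intro continuous_intros)
qed

lemma norm_sq_cart: "(norm x)\<^sup>2 = (\<Sum>j\<in>UNIV. (x $ j)\<^sup>2)" for x :: "real ^ 'd"
  unfolding power2_norm_eq_inner inner_vec_def by (simp add: power2_eq_square)

lemma Phi_lower_bound:
  fixes \<xi> :: "real ^ 'd"
  assumes "\<xi> \<in> cbox (\<chi> j. - pi) (\<chi> j. pi)"
  shows "4 / pi\<^sup>2 * (norm \<xi>)\<^sup>2 \<le> Phi \<xi>"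
  unfolding Phi_def norm_sq_cart sum_distrib_left
  by (intro sum_mono two_minus_two_cos_lower_bound) (use assms in \<open>auto simp: mem_torus_box\<close>)

lemma lattice_heat_factorises:
  fixes k :: "int ^ 'd"
  shows "lattice_heat s (lattice_vec k) = (\<Prod>j\<in>UNIV. torus_heat_fourier 0 0 s (k $ j))"
proof -
  define h where "h j \<theta> = indicat_real {- pi..pi} \<theta> *\<^sub>R (complex_of_real (sin \<theta> ^ 0 * cos \<theta> ^ 0 * exp (- s * (2 - 2 * cos \<theta>))) *
     exp (\<i> * complex_of_real (of_int (k $ j) * \<theta>)))" for j \<theta>
  have i: "integrable lborel (h j)" for j
    using torus_heat_fourier_integrable[of 0 0 s "k $ j"] unfolding h_def set_integrable_def .
  have "(indicator (cbox (\<chi> j. - pi) (\<chi> j. pi)) \<xi> *\<^sub>R exp (\<i> * complex_of_real (lattice_vec k \<bullet> \<xi>))) *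
     complex_of_real (exp (- s * Phi \<xi>)) = (\<Prod>j\<in>UNIV. h j (\<xi> $ j))" for \<xi> :: "real ^ 'd"
  proof (cases "\<xi> \<in> cbox (\<chi> j. - pi) (\<chi> j. pi)")
    case True
    then have "h j (\<xi> $ j) = complex_of_real (exp (- s * (2 - 2 * cos (\<xi> $ j)))) * exp (\<i> * complex_of_real (of_int (k $ j) * \<xi> $ j))" for j
      unfolding mem_torus_box by (auto simp: h_def abs_le_iff minus_le_iff)
    then have "(\<Prod>j\<in>UNIV. h j (\<xi> $ j)) = complex_of_real (exp (- s * Phi \<xi>)) * exp (\<i> * complex_of_real (lattice_vec k \<bullet> \<xi>))"
      by (simp only: prod.distrib of_real_prod[symmetric] exp_sum[OF finite, symmetric])
         (simp add: Phi_def sum_distrib_left inner_vec_def lattice_vec_def sum_negf[symmetric])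
    then show ?thesis using True by simp
  next
    case False
    then obtain j where "\<not> \<bar>\<xi> $ j\<bar> \<le> pi" unfolding mem_torus_box by auto
    then have "h j (\<xi> $ j) = 0" by (auto simp: h_def indicator_def)
    then have "(\<Prod>j\<in>UNIV. h j (\<xi> $ j)) = 0" by (intro prod_zero) auto
    then show ?thesis using False by simp
  qed
  then have "lattice_heat s (lattice_vec k) = (LINT \<xi>|lborel. (\<Prod>j\<in>UNIV. h j (\<xi> $ j)))"
    unfolding lattice_heat_def by (simp only:)
  also have "\<dots> = (\<Prod>j\<in>UNIV. integral\<^sup>L lborel (h j))"
    by (rule integral_prod_cart[OF i])
  finally show ?thesis
    unfolding torus_heat_fourier_def set_lebesgue_integral_def h_def .
qed

text \<open>The coordinate of \<open>k\<close> of largest modulus is at least \<open>\<bar>k\<bar> / d\<close>. The factor of that coordinate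
receives all \<open>d\<close> integrations by parts and gains \<open>\<bar>k\<bar> powr - d\<close> at the price \<open>R powr (1 - d)\<close>;
the other \<open>d - 1\<close> factors are at most a multiple of \<open>R\<close> each and pay this price exactly.\<close>

lemma lattice_heat_bound:
  "\<exists>C\<ge>0. \<forall>(k :: int ^ 'd) u. lattice_vec k \<noteq> 0 \<longrightarrow> u > 0 \<longrightarrow>
     norm (lattice_vec k) ^ CARD('d) * norm (lattice_heat ((norm (lattice_vec k))\<^sup>2 * u) (lattice_vec k))
     \<le> C * min 1 (u powr - (real CARD('d) / 2))"
proof -
  let ?d = "CARD('d)"
  \<comment> \<open>Each coordinate factor is estimated in two ways: trivially, and after \<open>d\<close> integrations by parts.\<close>
  obtain C0 where C0: "C0 \<ge> 0" "\<And>s k. s > 0 \<Longrightarrow> \<bar>real_of_int k\<bar> ^ 0 * norm (torus_heat_fourier 0 0 s k)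
      \<le> C0 * min pi (1 / sqrt s) powr (real (1 + 0) - real 0)" using torus_heat_fourier_decay[of 0 0 0] by blast
  obtain C1 where C1: "C1 \<ge> 0" "\<And>s k. s > 0 \<Longrightarrow> \<bar>real_of_int k\<bar> ^ ?d * norm (torus_heat_fourier 0 0 s k)
      \<le> C1 * min pi (1 / sqrt s) powr (real (1 + 0) - real ?d)" using torus_heat_fourier_decay[of ?d 0 0] by blast
  \<comment> \<open>The first factor comes from \<open>\<bar>k\<bar> \<le> d * \<bar>k $ j\<bar>\<close> for the coordinate \<open>j\<close> of largest modulus.\<close>
  define D where "D = real ?d ^ ?d * C1 * C0 ^ (?d - 1)"
  show ?thesis
  proof (intro exI[of _ "max (C0 ^ ?d) D"] conjI allI impI)
    show "max (C0 ^ ?d) D \<ge> 0" using C0(1) by (simp add: max.coboundedI1)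
    fix k :: "int ^ 'd" and u :: real assume k: "lattice_vec k \<noteq> 0" and u: "u > 0"
    define r where "r = norm (lattice_vec k)"
    define s where "s = r\<^sup>2 * u"
    define R where "R = min pi (1 / sqrt s)"
    have r: "r > 0" using k by (simp add: r_def)
    have s: "s > 0" using r u by (simp add: s_def)
    have R: "R > 0" using s by (simp add: R_def)
    have h0: "norm (torus_heat_fourier 0 0 s j) \<le> C0 * R" for j
      using C0(2)[OF s, of j] R by (simp add: R_def[symmetric])
    have "norm (lattice_heat s (lattice_vec k)) \<le> (\<Prod>j\<in>(UNIV::'d set). C0 * R)"
      unfolding lattice_heat_factorises prod_norm[symmetric] by (intro prod_mono) (auto intro: h0)
    also have "\<dots> = (C0 * R) ^ ?d" by simp
    also have "\<dots> \<le> (C0 * (1 / sqrt s)) ^ ?d"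
      using C0(1) R by (intro power_mono mult_left_mono mult_nonneg_nonneg) (auto simp: R_def)
    also have "\<dots> = C0 ^ ?d * (1 / sqrt u) ^ ?d / r ^ ?d"
      using r by (simp add: s_def real_sqrt_mult power_mult_distrib power_divide)
    finally have "r ^ ?d * norm (lattice_heat s (lattice_vec k)) \<le> C0 ^ ?d * (1 / sqrt u) ^ ?d"
      by (metis mult.commute pos_le_divide_eq r zero_less_power)
    also have "\<dots> \<le> max (C0 ^ ?d) D * (1 / sqrt u) ^ ?d"
      using u by (intro mult_right_mono) auto
    finally have 1: "r ^ ?d * norm (lattice_heat s (lattice_vec k)) \<le> max (C0 ^ ?d) D * u powr - (real ?d / 2)"
      unfolding inverse_sqrt_power[OF u] .
    obtain j where j: "r \<le> real ?d * \<bar>real_of_int (k $ j)\<bar>"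
    proof -
      define M where "M = Max (range (\<lambda>j. \<bar>real_of_int (k $ j)\<bar>))"
      have "M \<in> range (\<lambda>j. \<bar>real_of_int (k $ j)\<bar>)" unfolding M_def by (intro Max_in) auto
      then obtain j where j: "M = \<bar>real_of_int (k $ j)\<bar>" by auto
      have "r \<le> (\<Sum>j\<in>UNIV. \<bar>lattice_vec k $ j\<bar>)" unfolding r_def by (rule norm_le_l1_cart)
      also have "\<dots> \<le> (\<Sum>j\<in>(UNIV::'d set). M)"
        by (intro sum_mono) (auto simp: M_def lattice_vec_def intro: Max_ge)
      finally show ?thesis using that j by simp
    qed
    have "r ^ ?d * norm (lattice_heat s (lattice_vec k))
      = r ^ ?d * (norm (torus_heat_fourier 0 0 s (k $ j)) * (\<Prod>i\<in>UNIV - {j}. norm (torus_heat_fourier 0 0 s (k $ i))))"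
      unfolding lattice_heat_factorises prod_norm[symmetric] by (subst prod.remove[of UNIV j]) auto
    also have "\<dots> \<le> (real ?d * \<bar>real_of_int (k $ j)\<bar>) ^ ?d * (norm (torus_heat_fourier 0 0 s (k $ j)) * (\<Prod>i\<in>UNIV - {j}. C0 * R))"
      using r j by (intro mult_mono power_mono mult_left_mono prod_mono conjI h0 mult_nonneg_nonneg prod_nonneg) auto
    also have "(\<Prod>i\<in>UNIV - {j}. C0 * R) = (C0 * R) ^ (?d - 1)" by (simp add: card_Diff_singleton)
    also have "(real ?d * \<bar>real_of_int (k $ j)\<bar>) ^ ?d * (norm (torus_heat_fourier 0 0 s (k $ j)) * (C0 * R) ^ (?d - 1))
       = real ?d ^ ?d * C0 ^ (?d - 1) * R ^ (?d - 1) * (\<bar>real_of_int (k $ j)\<bar> ^ ?d * norm (torus_heat_fourier 0 0 s (k $ j)))"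
      by (simp add: power_mult_distrib mult_ac)
    also have "\<dots> \<le> real ?d ^ ?d * C0 ^ (?d - 1) * R ^ (?d - 1) * (C1 * R powr (real (1 + 0) - real ?d))"
      using C1(2)[OF s, of "k $ j"] R C0(1) unfolding R_def[symmetric] by (intro mult_left_mono) auto
    also have "\<dots> = D * (R ^ (?d - 1) * R powr (real (1 + 0) - real ?d))" by (simp add: D_def mult_ac)
    also have "R ^ (?d - 1) * R powr (real (1 + 0) - real ?d) = 1"
    proof -
      have "R ^ (?d - 1) = R powr (real (?d - 1))" by (rule powr_realpow[OF R, symmetric])
      moreover have "real (?d - 1) + (real (1 + 0) - real ?d) = 0" by (simp add: of_nat_diff)
      ultimately show ?thesis using R by (simp flip: powr_add)
    qed
    finally have "r ^ ?d * norm (lattice_heat s (lattice_vec k)) \<le> max (C0 ^ ?d) D * 1" by simp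
    with 1 show "norm (lattice_vec k) ^ ?d * norm (lattice_heat ((norm (lattice_vec k))\<^sup>2 * u) (lattice_vec k))
     \<le> max (C0 ^ ?d) D * min 1 (u powr - (real ?d / 2))"
      unfolding r_def[symmetric] s_def[symmetric] by (simp add: min_def)
  qed
qed

text \<open>After the substitution \<open>\<xi> = x / r\<close> with \<open>r = \<bar>z\<bar>\<close> the integrand has the phase \<open>(z / r) \<bullet> x\<close>, whose
direction may keep turning with \<open>n\<close>. The moduli converge in \<open>L\<^sup>1\<close> to the Gaussian, hence the
Fourier integrals differ from those of the Gaussian by a null sequence, whatever the directions,
and the latter do not depend on the unit vector \<open>z / r\<close>.\<close>

lemma lattice_heat_limit:
  fixes z :: "nat \<Rightarrow> real ^ 'd"
  assumes lim: "filterlim (\<lambda>n. norm (z n)) at_top sequentially" and z: "\<And>n. norm (z n) > 0" and u: "u > 0"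
  shows "(\<lambda>n. of_real (norm (z n) ^ CARD('d)) * lattice_heat ((norm (z n))\<^sup>2 * u) (z n))
    \<longlonglongrightarrow> complex_of_real (sqrt (pi / u) ^ CARD('d) * exp (- 1 / (4 * u)))"
proof -
  let ?B = "cbox (\<chi> j. - pi) (\<chi> j. pi) :: (real ^ 'd) set"
  define r where "r n = norm (z n)" for n
  have r: "r n > 0" for n using z by (simp add: r_def)
  define m where "m n x = indicat_real ?B (x /\<^sub>R r n) * exp (- ((r n)\<^sup>2 * u) * Phi (x /\<^sub>R r n))" for n x
  define g where "g x = exp (- u * (norm x)\<^sup>2)" for x :: "real ^ 'd"
  define E where "E n x = exp (\<i> * complex_of_real ((z n /\<^sub>R r n) \<bullet> x))" for n x
  have [measurable]: "m n \<in> borel_measurable borel" for n unfolding m_def by measurable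
  have [measurable]: "g \<in> borel_measurable borel" unfolding g_def by measurable
  have [measurable]: "E n \<in> borel_measurable borel" for n unfolding E_def by measurable
  have nE: "norm (E n x) = 1" for n x by (simp add: E_def)
  have eq: "of_real (norm (z n) ^ CARD('d)) * lattice_heat ((norm (z n))\<^sup>2 * u) (z n)
     = (LINT x|lborel. complex_of_real (m n x) * E n x)" for n
  proof -
    have "(LINT x|lborel. complex_of_real (m n x) * E n x)
      = of_real (r n ^ DIM(real^'d)) * (LINT x|lborel. complex_of_real (m n (r n *\<^sub>R x)) * E n (r n *\<^sub>R x))"
      by (rule lborel_integral_scaleR[OF _ r]) measurable
    also have "(LINT x|lborel. complex_of_real (m n (r n *\<^sub>R x)) * E n (r n *\<^sub>R x)) = lattice_heat ((r n)\<^sup>2 * u) (z n)"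
    proof -
      have a: "r n *\<^sub>R x /\<^sub>R r n = x" "(z n /\<^sub>R r n) \<bullet> (r n *\<^sub>R x) = z n \<bullet> x" for x
        using r[of n] by auto
      show ?thesis unfolding lattice_heat_def m_def E_def a
        by (intro Bochner_Integration.integral_cong) (auto simp: indicator_def mult_ac)
    qed
    finally show ?thesis by (simp add: r_def)
  qed
  define c where "c = u * (4 / pi\<^sup>2)"
  have c: "c > 0" using u by (simp add: c_def)
  have mb: "norm (m n x) \<le> exp (- c * (norm x)\<^sup>2)" for n x
  proof (cases "x /\<^sub>R r n \<in> ?B")
    case True
    have "u * (norm x)\<^sup>2 * (4 / pi\<^sup>2) = (r n)\<^sup>2 * u * (4 / pi\<^sup>2 * (norm (x /\<^sub>R r n))\<^sup>2)"
      using r[of n] by (simp add: power_mult_distrib field_simps)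
    also have "\<dots> \<le> (r n)\<^sup>2 * u * Phi (x /\<^sub>R r n)"
      using u by (intro mult_left_mono Phi_lower_bound True) auto
    finally show ?thesis using True by (simp add: m_def c_def mult_ac)
  qed (simp add: m_def)
  have gi: "integrable lborel g" unfolding g_def by (rule gaussian_integral(1)[OF u])
  have ci: "integrable lborel (\<lambda>x::real^'d. exp (- c * (norm x)\<^sup>2))" by (rule gaussian_integral(1)[OF c])
  have mi: "integrable lborel (m n)" for n
    using mb[of n] by (intro Bochner_Integration.integrable_bound[OF ci]) auto
  have pw: "(\<lambda>n. m n x) \<longlonglongrightarrow> g x" for x
  proof -
    have "eventually (\<lambda>n. r n \<ge> norm x) sequentially"
      using lim unfolding filterlim_at_top r_def by blast
    then have "eventually (\<lambda>n. indicat_real ?B (x /\<^sub>R r n) = 1) sequentially"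
    proof eventually_elim
      case (elim n)
      have "\<bar>(x /\<^sub>R r n) $ j\<bar> \<le> pi" for j
      proof -
        have "\<bar>(x /\<^sub>R r n) $ j\<bar> \<le> norm (x /\<^sub>R r n)" by (rule component_le_norm_cart)
        also have "\<dots> \<le> 1" using elim r[of n] by (simp add: field_simps)
        also have "\<dots> \<le> pi" using pi_ge_two by simp
        finally show ?thesis .
      qed
      then show ?case by (simp add: mem_torus_box)
    qed
    then have 1: "(\<lambda>n. indicat_real ?B (x /\<^sub>R r n)) \<longlonglongrightarrow> 1" by (rule tendsto_eventually)
    have cl: "((\<lambda>\<rho>. \<rho>\<^sup>2 * (2 - 2 * cos (y / \<rho>))) \<longlongrightarrow> y\<^sup>2) at_top" for y :: real
      unfolding power2_eq_square[of y] by real_asymp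
    have "(\<lambda>n. \<Sum>j\<in>UNIV. (r n)\<^sup>2 * (2 - 2 * cos (x $ j / r n))) \<longlonglongrightarrow> (\<Sum>j\<in>UNIV. (x $ j)\<^sup>2)"
      by (intro tendsto_sum filterlim_compose[OF cl]) (use lim in \<open>simp add: r_def\<close>)
    then have 2: "(\<lambda>n. (r n)\<^sup>2 * Phi (x /\<^sub>R r n)) \<longlonglongrightarrow> (norm x)\<^sup>2"
      unfolding norm_sq_cart Phi_def sum_distrib_left by (simp add: divide_inverse mult.commute)
    have "(\<lambda>n. indicat_real ?B (x /\<^sub>R r n) * exp (- u * ((r n)\<^sup>2 * Phi (x /\<^sub>R r n)))) \<longlonglongrightarrow> 1 * exp (- u * (norm x)\<^sup>2)"
      by (intro tendsto_intros 1 2)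
    then show ?thesis unfolding m_def g_def by (simp add: mult_ac)
  qed
  have d0: "(\<lambda>n. LINT x|lborel. norm (m n x - g x)) \<longlonglongrightarrow> (LINT x::real^'d|lborel. 0)"
  proof (rule integral_dominated_convergence)
    show "integrable lborel (\<lambda>x. exp (- c * (norm x)\<^sup>2) + g x)" by (intro Bochner_Integration.integrable_add ci gi)
    show "AE x in lborel. (\<lambda>n. norm (m n x - g x)) \<longlonglongrightarrow> 0"
      using pw by (intro AE_I2 tendsto_norm_zero) (simp add: LIM_zero_iff)
    show "AE x in lborel. norm (norm (m n x - g x)) \<le> exp (- c * (norm x)\<^sup>2) + g x" for n
    proof (rule AE_I2)
      fix x :: "real ^ 'd"
      have "norm (m n x - g x) \<le> norm (m n x) + norm (g x)" by (rule norm_triangle_ineq4)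
      then show "norm (norm (m n x - g x)) \<le> exp (- c * (norm x)\<^sup>2) + g x"
        using mb[of n x] by (simp add: g_def)
    qed
  qed measurable
  have val: "(LINT x|lborel. complex_of_real (g x) * E n x) = complex_of_real (sqrt (pi / u) ^ CARD('d) * exp (- 1 / (4 * u)))" for n
  proof -
    \<comment> \<open>The Gaussian transform sees the direction of \<open>z n\<close> only through this norm.\<close>
    have "norm (z n /\<^sub>R r n) = 1" using r[of n] by (simp add: r_def)
    then show ?thesis unfolding g_def E_def gaussian_fourier(2)[OF u] by simp
  qed
  have "(\<lambda>n. (LINT x|lborel. complex_of_real (m n x) * E n x) - (LINT x|lborel. complex_of_real (g x) * E n x)) \<longlonglongrightarrow> 0"
  proof (rule Lim_null_comparison[OF always_eventually[rule_format]])
    show "(\<lambda>n. LINT x|lborel. norm (m n x - g x)) \<longlonglongrightarrow> 0" using d0 by simp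
    fix n
    have a: "integrable lborel (\<lambda>x. complex_of_real (m n x) * E n x)"
      using nE by (intro Bochner_Integration.integrable_bound[OF mi[of n]]) (auto simp: norm_mult)
    have b: "integrable lborel (\<lambda>x. complex_of_real (g x) * E n x)"
      using nE by (intro Bochner_Integration.integrable_bound[OF gi]) (auto simp: norm_mult)
    have "norm (LINT x|lborel. complex_of_real (m n x) * E n x - complex_of_real (g x) * E n x) \<le> (LINT x|lborel. norm (m n x - g x))"
    proof (rule Bochner_Integration.integral_norm_bound_integral)
      show "integrable lborel (\<lambda>x. complex_of_real (m n x) * E n x - complex_of_real (g x) * E n x)"
        using a b by simp
      show "integrable lborel (\<lambda>x. norm (m n x - g x))" using mi[of n] gi by simp
      fix x :: "real ^ 'd"
      have "norm (complex_of_real (m n x - g x) * E n x) = norm (m n x - g x)"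
        unfolding norm_mult nE by (simp only: norm_of_real real_norm_def mult_1_right)
      then show "norm (complex_of_real (m n x) * E n x - complex_of_real (g x) * E n x) \<le> norm (m n x - g x)"
        by (simp add: left_diff_distrib)
    qed
    then show "norm ((LINT x|lborel. complex_of_real (m n x) * E n x) - (LINT x|lborel. complex_of_real (g x) * E n x))
       \<le> (LINT x|lborel. norm (m n x - g x))" using a b by simp
  qed
  then show ?thesis unfolding eq val by (simp only: LIM_zero_iff)
qed

section \<open>Asymptotics of the log-diffusion kernel\<close>

lemma p_log_subordination:
  fixes x y :: "int ^ 'd"
  assumes t: "0 < t" "t < real CARD('d) / 2"
  shows "p_log t x y = complex_of_real (1 / (2 * pi) ^ CARD('d)) * (complex_of_real (1 / Gamma t) *
    (LINT s:{0<..}|lborel. complex_of_real (s powr (t - 1)) * lattice_heat s (lattice_vec x - lattice_vec y)))"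
proof -
  let ?B = "cbox (\<chi> j. - pi) (\<chi> j. pi) :: (real ^ 'd) set"
  define f where "f \<xi> = indicat_real ?B \<xi> *\<^sub>R exp (\<i> * complex_of_real ((lattice_vec x - lattice_vec y) \<bullet> \<xi>))" for \<xi>
  have fB: "\<xi> \<in> ?B" if "f \<xi> \<noteq> 0" for \<xi> using that by (auto simp: f_def indicator_def split: if_splits)
  have "(LINT \<xi>|lborel. complex_of_real (Phi \<xi> powr - t) * f \<xi>) =
    complex_of_real (1 / Gamma t) * (LINT s:{0<..}|lborel. complex_of_real (s powr (t - 1)) *
      (LINT \<xi>|lborel. f \<xi> * complex_of_real (exp (- s * Phi \<xi>))))"
  \<comment> \<open>The radius \<open>d * pi\<close> comes from bounding the Euclidean norm by the sum of the coordinates.\<close>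
  proof (rule subordination_on_ball[where K=1 and L="real CARD('d) * pi" and c="4 / pi\<^sup>2"])
    show "f \<in> borel_measurable borel" unfolding f_def by measurable
    show "norm (f \<xi>) \<le> 1" for \<xi> by (auto simp: f_def indicator_def)
    show "f \<xi> = 0" if "norm \<xi> > real CARD('d) * pi" for \<xi>
    proof (rule ccontr)
      assume "f \<xi> \<noteq> 0"
      then have "\<bar>\<xi> $ j\<bar> \<le> pi" for j using fB by (auto simp: mem_torus_box)
      then have "(\<Sum>j\<in>UNIV. \<bar>\<xi> $ j\<bar>) \<le> (\<Sum>j\<in>(UNIV::'d set). pi)" by (intro sum_mono)
      then show False using norm_le_l1_cart[of \<xi>] that by simp
    qed
    show "4 / pi\<^sup>2 * (norm \<xi>)\<^sup>2 \<le> Phi \<xi>" if "f \<xi> \<noteq> 0" for \<xi>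
      by (rule Phi_lower_bound[OF fB[OF that]])
  qed (use t in auto)
  moreover have "(LINT \<xi> : ?B | lborel. complex_of_real (Phi \<xi> powr (- t)) *
        exp (\<i> * complex_of_real ((lattice_vec x - lattice_vec y) \<bullet> \<xi>))) = (LINT \<xi>|lborel. complex_of_real (Phi \<xi> powr - t) * f \<xi>)"
    unfolding set_lebesgue_integral_def f_def by simp
  ultimately show ?thesis
    unfolding p_log_def lattice_heat_def f_def by (simp only:)
qed

text \<open>The substitution \<open>s = r\<^sup>2 u\<close> turns the normalisation \<open>r powr (d - 2 * t)\<close> into the factor
\<open>r ^ d\<close>, the one natural for a heat kernel at spatial scale \<open>r\<close>.\<close>

lemma subordination_rescale:
  fixes H :: "real \<Rightarrow> complex"
  assumes r: "r > 0"
  shows "complex_of_real (r powr (real d - 2 * t)) * (LINT s:{0<..}|lborel. complex_of_real (s powr (t - 1)) * H s)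
    = (LINT u:{0<..}|lborel. complex_of_real (u powr (t - 1)) * (of_real (r ^ d) * H (r\<^sup>2 * u)))"
proof -
  let ?c = "r powr (real d - 2 * t)"
  have r2: "r\<^sup>2 > 0" using r by simp
  have "(LINT s:{0<..}|lborel. complex_of_real (s powr (t - 1)) * H s)
    = \<bar>r\<^sup>2\<bar> *\<^sub>R (LINT u|lborel. indicat_real {0<..} (0 + r\<^sup>2 * u) *\<^sub>R (complex_of_real ((0 + r\<^sup>2 * u) powr (t - 1)) * H (0 + r\<^sup>2 * u)))"
    unfolding set_lebesgue_integral_def using r2 by (intro lborel_integral_real_affine) simp
  then have "complex_of_real ?c * (LINT s:{0<..}|lborel. complex_of_real (s powr (t - 1)) * H s)
    = (LINT u|lborel. complex_of_real ?c * (of_real (r\<^sup>2) * (indicat_real {0<..} (0 + r\<^sup>2 * u) *\<^sub>R (complex_of_real ((0 + r\<^sup>2 * u) powr (t - 1)) * H (0 + r\<^sup>2 * u)))))"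
    by (simp add: scaleR_conv_of_real)
  also have "\<dots> = (LINT u:{0<..}|lborel. complex_of_real (u powr (t - 1)) * (of_real (r ^ d) * H (r\<^sup>2 * u)))"
    unfolding set_lebesgue_integral_def
  proof (intro Bochner_Integration.integral_cong refl)
    fix u :: real
    show "complex_of_real ?c * (of_real (r\<^sup>2) * (indicat_real {0<..} (0 + r\<^sup>2 * u) *\<^sub>R (complex_of_real ((0 + r\<^sup>2 * u) powr (t - 1)) * H (0 + r\<^sup>2 * u))))
      = indicat_real {0<..} u *\<^sub>R (complex_of_real (u powr (t - 1)) * (of_real (r ^ d) * H (r\<^sup>2 * u)))"
    proof (cases "u > 0")
      case True
      have e: "?c * r\<^sup>2 * (r\<^sup>2 * u) powr (t - 1) = u powr (t - 1) * r ^ d"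
      proof -
        have "(r\<^sup>2 * u) powr (t - 1) = (r powr 2) powr (t - 1) * u powr (t - 1)"
          using r True by (simp add: powr_mult)
        also have "(r powr 2) powr (t - 1) = r powr (2 * (t - 1))" by (rule powr_powr)
        finally have "?c * r\<^sup>2 * (r\<^sup>2 * u) powr (t - 1) = (?c * r powr 2 * r powr (2 * (t - 1))) * u powr (t - 1)"
          using r by simp
        also have "?c * r powr 2 * r powr (2 * (t - 1)) = r powr (real d)"
          unfolding powr_add[symmetric] by (simp add: algebra_simps)
        finally show ?thesis using r by (simp add: powr_realpow mult.commute)
      qed
      have "complex_of_real ?c * (of_real (r\<^sup>2) * (complex_of_real ((r\<^sup>2 * u) powr (t - 1)) * H (r\<^sup>2 * u)))
        = complex_of_real (?c * r\<^sup>2 * (r\<^sup>2 * u) powr (t - 1)) * H (r\<^sup>2 * u)"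
        by (simp only: of_real_mult mult.assoc)
      also have "\<dots> = complex_of_real (u powr (t - 1)) * (of_real (r ^ d) * H (r\<^sup>2 * u))"
        unfolding e by (simp only: of_real_mult mult.assoc)
      finally show ?thesis using True r2 by simp
    next
      case False
      then have "\<not> r\<^sup>2 * u > 0" using r2 by (simp add: zero_less_mult_iff)
      then show ?thesis using False by simp
    qed
  qed
  finally show ?thesis .
qed

lemma p_log_tendsto:
  assumes t: "0 < t" "t < real CARD('d) / 2"
  shows "((\<lambda>(x :: int ^ 'd, y :: int ^ 'd).
        complex_of_real (norm (lattice_vec x - lattice_vec y) powr (real CARD('d) - 2 * t)) * p_log t x y)
      \<longlongrightarrow> riesz_constant t CARD('d) / complex_of_real ((2 * pi) ^ CARD('d)))
      (filtercomap (\<lambda>(x, y). norm (lattice_vec x - lattice_vec y)) at_top)"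
proof (rule tendsto_filtercomap_at_top_sequentially)
  let ?d = "CARD('d)"
  fix X :: "nat \<Rightarrow> (int ^ 'd) \<times> (int ^ 'd)"
  define k where "k n = fst (X n) - snd (X n)" for n
  define z where "z n = (lattice_vec (k n) :: real ^ 'd)" for n
  have zd: "z n = lattice_vec (fst (X n)) - lattice_vec (snd (X n))" for n
    by (simp add: z_def k_def lattice_vec_def vec_eq_iff)
  assume "filterlim (\<lambda>n. case X n of (x, y) \<Rightarrow> norm (lattice_vec x - lattice_vec y)) at_top sequentially"
  then have lim: "filterlim (\<lambda>n. norm (z n)) at_top sequentially" by (simp add: zd case_prod_beta)
  assume "\<And>n. 1 \<le> (case X n of (x, y) \<Rightarrow> norm (lattice_vec x - lattice_vec y))"
  then have z1: "norm (z n) \<ge> 1" for n by (simp add: zd case_prod_beta)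
  have z0: "norm (z n) > 0" for n by (rule less_le_trans[OF zero_less_one z1])
  define G where "G n u = of_real (norm (z n) ^ ?d) * lattice_heat ((norm (z n))\<^sup>2 * u) (z n)" for n u
  obtain C where C: "\<And>(k :: int ^ 'd) u. lattice_vec k \<noteq> 0 \<Longrightarrow> u > 0 \<Longrightarrow>
     norm (lattice_vec k) ^ ?d * norm (lattice_heat ((norm (lattice_vec k))\<^sup>2 * u) (lattice_vec k))
     \<le> C * min 1 (u powr - (real ?d / 2))" using lattice_heat_bound[where 'd='d] by blast
  have eq: "(case X n of (x, y) \<Rightarrow> complex_of_real (norm (lattice_vec x - lattice_vec y) powr (real ?d - 2 * t)) * p_log t x y)
    = complex_of_real (1 / (2 * pi) ^ ?d) * (complex_of_real (1 / Gamma t) *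
       (LINT u:{0<..}|lborel. complex_of_real (u powr (t - 1)) * G n u))" for n
    unfolding G_def subordination_rescale[OF z0, where H="\<lambda>s. lattice_heat s (z _)", symmetric]
      case_prod_beta zd[symmetric] p_log_subordination[OF t]
    by (simp only: mult_ac)
  have "(\<lambda>n. complex_of_real (1 / (2 * pi) ^ ?d) * (complex_of_real (1 / Gamma t) *
       (LINT u:{0<..}|lborel. complex_of_real (u powr (t - 1)) * G n u)))
    \<longlonglongrightarrow> complex_of_real (1 / (2 * pi) ^ ?d) * riesz_constant t ?d"
    unfolding riesz_constant_def
  proof (intro tendsto_mult_left subordinated_limit[OF t])
    show "G n \<in> borel_measurable borel" for n unfolding G_def lattice_heat_def by measurable
    show "norm (G n s) \<le> C * min 1 (s powr - (real ?d / 2))" if "s > 0" for n s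
      using C[of "k n" s] that z0[of n] unfolding G_def z_def by (simp add: norm_mult norm_power)
    show "(\<lambda>n. G n s) \<longlonglongrightarrow> complex_of_real (sqrt (pi / s) ^ ?d * exp (- 1 / (4 * s)))" if "s > 0" for s
      unfolding G_def by (rule lattice_heat_limit[OF lim z0 that])
  qed measurable
  then show "(\<lambda>n. case X n of (x, y) \<Rightarrow> complex_of_real (norm (lattice_vec x - lattice_vec y) powr (real ?d - 2 * t)) * p_log t x y)
    \<longlonglongrightarrow> riesz_constant t ?d / complex_of_real ((2 * pi) ^ ?d)"
    unfolding eq by simp
qed

theorem proposition1p13:
  fixes t :: real and \<kappa> :: "real ^ 'd \<Rightarrow> complex" and \<omega> :: "real ^ 'd"
  assumes "0 < t" and "t < real CARD('d) / 2"
    and "radial_cutoff \<kappa>" and "norm \<omega> = 1"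
  shows "(A_trunc t \<kappa> \<omega> \<longlongrightarrow> A_const t \<kappa> \<omega>) at_top \<and>
    (\<forall>(\<kappa>' :: real ^ 'd \<Rightarrow> complex) (\<omega>' :: real ^ 'd).
        radial_cutoff \<kappa>' \<longrightarrow> norm \<omega>' = 1 \<longrightarrow> A_const t \<kappa>' \<omega>' = A_const t \<kappa> \<omega>) \<and>
    ((\<lambda>(x :: int ^ 'd, y :: int ^ 'd).
        complex_of_real (norm (lattice_vec x - lattice_vec y) powr (real CARD('d) - 2 * t)) *
        p_log t x y)
      \<longlongrightarrow> A_const t \<kappa> \<omega> / complex_of_real ((2 * pi) ^ CARD('d)))
      (filtercomap (\<lambda>(x, y). norm (lattice_vec x - lattice_vec y)) at_top)"
proof -
  have A: "A_const t \<kappa>' \<omega>' = riesz_constant t CARD('d)"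
    if "radial_cutoff \<kappa>'" "norm \<omega>' = 1" for \<kappa>' :: "real ^ 'd \<Rightarrow> complex" and \<omega>'
    unfolding A_const_def using A_trunc_tendsto[OF assms(1,2) that] by (intro tendsto_Lim) auto
  show ?thesis
    using A A_trunc_tendsto[OF assms] p_log_tendsto[OF assms(1,2)] A[OF assms(3,4)] by simp
qed

end
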